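(* Let $\rho$ be a positive Borel measure on $(0,\infty)$. Then the following are equivalent: (1) $\rho((0,1))=0$ and $\int_{[1,\infty)}\frac1t\,d\rho(t)<\infty$; (2) $H_\rho$ is bounded on $F^2$; (3) $H_\rho\in\mathcal{T}$.
   Context: $\mu$ is the Gaussian measure $d\mu(z)=\frac1\pi e^{-|z|^2}dz$ on $\mathbb{C}$, and $F^2=L^2(\mathbb{C},\mu)\cap\operatorname{Hol}(\mathbb{C})$ is the Fock space. Let $P$ be the orthogonal projection of $L^2(\mathbb{C},\mu)$ onto $F^2$; for $f\in L^\infty(\mathbb{C})$ the Toeplitz operator is $T_f g=P(fg)$, $g\in F^2$. The Toeplitz algebra $\mathcal{T}\subset\mathcal{L}(F^2)$ is the $C^*$-algebra generated by all $T_f$, $f\in L^\infty(\mathbb{C})$. The Hausdorff operator $H_\rho$ acts formally by $H_\rho f(z)=\int_{(0,\infty)}f\left(\frac zt\right)\frac1t\,d\rho(t)$. That $H_\rho$ is bounded on $F^2$ means that for every $f\in F^2$ the integral converges absolutely for all $z\in\mathbb{C}$, defines an element of $F^2$, and $f\mapsto H_\rho f$ is a bounded operator; $H_\rho\in\mathcal{T}$ means that $H_\rho$ is such a bounded operator and lies in $\mathcal{T}$. *)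

theory Defs
  imports "HOL-Analysis.Analysis"
begin

definition gauss :: "complex measure" where
  "gauss = density lborel (\<lambda>z. ennreal (exp (- (cmod z)\<^sup>2) / pi))"

text \<open>Square-integrable functions are not identified modulo null sets. On the Fock space this makes
  no difference: two entire functions that agree almost everywhere are equal.\<close>

definition L2_gauss :: "(complex \<Rightarrow> complex) set" where
  "L2_gauss = {f \<in> borel_measurable gauss. integrable gauss (\<lambda>z. (cmod (f z))\<^sup>2)}"

definition Fock :: "(complex \<Rightarrow> complex) set" where
  "Fock = L2_gauss \<inter> {f. f holomorphic_on UNIV}"

definition inner_gauss :: "(complex \<Rightarrow> complex) \<Rightarrow> (complex \<Rightarrow> complex) \<Rightarrow> complex" where
  "inner_gauss f g = (\<integral>z. f z * cnj (g z) \<partial>gauss)"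

definition norm_gauss :: "(complex \<Rightarrow> complex) \<Rightarrow> real" where
  "norm_gauss f = sqrt (\<integral>z. (cmod (f z))\<^sup>2 \<partial>gauss)"

definition Linf :: "(complex \<Rightarrow> complex) set" where
  "Linf = {f \<in> borel_measurable lborel. \<exists>C. AE z in lborel. cmod (f z) \<le> C}"

definition Fock_proj :: "(complex \<Rightarrow> complex) \<Rightarrow> complex \<Rightarrow> complex" where
  "Fock_proj h = (THE g. g \<in> Fock \<and> (\<forall>k\<in>Fock. inner_gauss (\<lambda>z. h z - g z) k = 0))"

type_synonym fun_op = "(complex \<Rightarrow> complex) \<Rightarrow> complex \<Rightarrow> complex"

text \<open>Operators on the Fock space are total functions of which only the values on \<open>Fock\<close> matter.\<close>

definition bounded_ops :: "fun_op set" where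
  "bounded_ops = {A.
     (\<forall>f\<in>Fock. A f \<in> Fock) \<and>
     (\<forall>f\<in>Fock. \<forall>g\<in>Fock. A (\<lambda>z. f z + g z) = (\<lambda>z. A f z + A g z)) \<and>
     (\<forall>c. \<forall>f\<in>Fock. A (\<lambda>z. c * f z) = (\<lambda>z. c * A f z)) \<and>
     (\<exists>C. \<forall>f\<in>Fock. norm_gauss (A f) \<le> C * norm_gauss f)}"

definition op_norm :: "fun_op \<Rightarrow> real" where
  "op_norm A = (SUP f\<in>{f \<in> Fock. norm_gauss f \<le> 1}. norm_gauss (A f))"

definition is_adjoint :: "fun_op \<Rightarrow> fun_op \<Rightarrow> bool" where
  "is_adjoint A B \<longleftrightarrow> (\<forall>f\<in>Fock. \<forall>g\<in>Fock. inner_gauss (A f) g = inner_gauss f (B g))"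

text \<open>Norm-closedness also makes such a set closed under changing an operator outside \<open>Fock\<close>, so
  membership depends only on the operator on the Fock space.\<close>

definition cstar_subalgebra :: "fun_op set \<Rightarrow> bool" where
  "cstar_subalgebra \<A> \<longleftrightarrow>
     \<A> \<subseteq> bounded_ops \<and>
     (\<forall>A\<in>\<A>. \<forall>B\<in>\<A>. (\<lambda>f z. A f z + B f z) \<in> \<A>) \<and>
     (\<forall>c. \<forall>A\<in>\<A>. (\<lambda>f z. c * A f z) \<in> \<A>) \<and>
     (\<forall>A\<in>\<A>. \<forall>B\<in>\<A>. A \<circ> B \<in> \<A>) \<and>
     (\<forall>A\<in>\<A>. \<forall>B\<in>bounded_ops. is_adjoint A B \<longrightarrow> B \<in> \<A>) \<and>
     (\<forall>S. \<forall>B\<in>bounded_ops. (\<forall>n. S n \<in> \<A>) \<longrightarrow>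
        (\<lambda>n. op_norm (\<lambda>f z. S n f z - B f z)) \<longlonglongrightarrow> 0 \<longrightarrow> B \<in> \<A>)"

definition Toeplitz :: "(complex \<Rightarrow> complex) \<Rightarrow> fun_op" where
  "Toeplitz f g = Fock_proj (\<lambda>z. f z * g z)"

definition Toeplitz_algebra :: "fun_op set" where
  "Toeplitz_algebra = cstar_subalgebra hull (Toeplitz ` Linf)"

definition Hausdorff :: "real measure \<Rightarrow> fun_op" where
  "Hausdorff \<rho> f z = (\<integral>t. f (z / of_real t) * of_real (1 / t) \<partial>\<rho>)"

definition Hausdorff_bounded :: "real measure \<Rightarrow> bool" where
  "Hausdorff_bounded \<rho> \<longleftrightarrow>
     (\<forall>f\<in>Fock. \<forall>z. integrable \<rho> (\<lambda>t. f (z / of_real t) * of_real (1 / t))) \<and>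
     Hausdorff \<rho> \<in> bounded_ops"

end

theory Submission
  imports Defs "HOL-Complex_Analysis.Complex_Analysis"
begin

text \<open>Write \<open>\<sigma>\<close> for the image of \<open>d\<rho>(t) / t\<close> under \<open>s = 1 / t\<close>, so that
  \<open>H\<^sub>\<rho> f (z) = \<integral> f (s z) d\<sigma>(s)\<close> is an average of dilations. By Parseval on circles and the rotation
  invariance of the Gaussian measure, dilation by \<open>s \<in> (0, 1]\<close> is a self-adjoint contraction of the Fock
  space; hence condition (1), which says that \<open>\<sigma>\<close> is a finite measure on \<open>(0, 1]\<close>, makes \<open>H\<^sub>\<rho>\<close>
  bounded with norm at most the mass of \<open>\<sigma>\<close>. Dilation by \<open>s\<close> is moreover the Toeplitz operator with
  symbol \<open>exp (- (1/s - 1) \<bar>z\<bar>\<^sup>2) / s\<close>, so if \<open>\<sigma>\<close> lives on \<open>[\<delta>, 1]\<close> with \<open>\<delta> > 0\<close>, then \<open>H\<^sub>\<rho>\<close> is the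
  Toeplitz operator whose symbol is the \<open>\<sigma>\<close>-integral of these bounded functions. The general case follows by
  truncation, since the part of \<open>\<sigma>\<close> on \<open>(0, \<delta>)\<close> contributes an operator of norm at most
  \<open>\<sigma> (0, \<delta>) \<longrightarrow> 0\<close>. Conversely, \<open>z\<^sup>n\<close> is an eigenvector of \<open>H\<^sub>\<rho>\<close> with eigenvalue \<open>\<integral> t\<^sup>-\<^sup>n\<^sup>-\<^sup>1 d\<rho>(t)\<close>,
  and these numbers are bounded in \<open>n\<close> only if \<open>\<rho>\<close> does not charge \<open>(0, 1)\<close>.\<close>

section \<open>Entire functions: Taylor series and bounds on discs\<close>

lemma entire_power_series:
  assumes "f holomorphic_on UNIV"
  obtains a :: "nat \<Rightarrow> complex" where "\<And>w. (\<lambda>n. a n * w ^ n) sums f w"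
proof
  fix w :: complex
  \<comment> \<open>The ball only has to contain \<open>w\<close>: the Taylor coefficients at 0 are
    the same for every radius, so one \<open>a\<close> serves all points.\<close>
  have "f holomorphic_on ball 0 (cmod w + 1)" using assms holomorphic_on_subset by blast
  from holomorphic_power_series[OF this, of w]
  show "(\<lambda>n. (deriv ^^ n) f 0 / fact n * w ^ n) sums f w" by simp
qed

lemma continuous_bounded_on_cball:
  fixes f :: "complex \<Rightarrow> 'a::real_normed_vector"
  assumes "continuous_on UNIV f"
  obtains K where "K \<ge> 0" "\<And>w. cmod w \<le> R \<Longrightarrow> norm (f w) \<le> K"
proof -
  have "compact (f ` cball 0 R)"
    using assms by (meson compact_cball compact_continuous_image continuous_on_subset subset_UNIV)
  then obtain K where K: "\<And>y. y \<in> f ` cball 0 R \<Longrightarrow> norm y \<le> K"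
    using compact_imp_bounded bounded_iff by metis
  show ?thesis
    \<comment> \<open>For negative \<open>R\<close> the disc is empty and \<open>K\<close> is
      unconstrained, hence the maximum with 0.\<close>
    by (rule that[of "max K 0"]) (auto intro!: max.coboundedI1 K)
qed

text \<open>A power series that converges at a point of larger modulus, here |w| + 1, converges
  absolutely at \<open>w\<close>.\<close>

lemma power_series_summable_norm:
  fixes a :: "nat \<Rightarrow> complex"
  assumes "\<And>w. (\<lambda>n. a n * w ^ n) sums f w"
  shows "summable (\<lambda>n. cmod (a n * w ^ n))"
  by (rule powser_insidea[of _ "complex_of_real (cmod w + 1)"])
     (use assms in \<open>auto simp: sums_iff simp del: of_real_add\<close>)

subsection \<open>Parseval on circles\<close>

text \<open>Normalised arc length in the angular coordinate. It is kept on the real line, so that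
  the mean of \<open>g\<close> over the circle through \<open>u\<close> is the integral of
  \<open>g (u * cis t)\<close>.\<close>

definition circle_measure :: "real measure" where
  "circle_measure = density lborel (\<lambda>t. ennreal (indicator {0..2*pi} t / (2 * pi)))"

lemma sets_circle_measure [measurable_cong, simp]: "sets circle_measure = sets borel"
  by (simp add: circle_measure_def)

lemma space_circle_measure [simp]: "space circle_measure = UNIV"
  by (simp add: circle_measure_def)

lemma emeasure_circle_measure: "emeasure circle_measure UNIV = 1"
proof -
  have "emeasure circle_measure UNIV = (\<integral>\<^sup>+ t. ennreal (1 / (2*pi)) * indicator {0..2*pi} t \<partial>lborel)"
    unfolding circle_measure_def
    by (subst emeasure_density) (auto intro!: nn_integral_cong split: split_indicator)
  also have "\<dots> = 1"
    by (subst nn_integral_cmult_indicator) (auto simp: ennreal_mult[symmetric])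
  finally show ?thesis .
qed

interpretation circle: finite_measure circle_measure
  by standard (simp add: emeasure_circle_measure)

lemma measure_circle_measure [simp]: "measure circle_measure UNIV = 1"
  by (simp add: measure_def emeasure_circle_measure)

lemma integrable_circle_bounded:
  fixes f :: "real \<Rightarrow> 'a::{banach,second_countable_topology}"
  assumes [measurable]: "f \<in> borel_measurable borel" and "\<And>t. norm (f t) \<le> K"
  shows "integrable circle_measure f"
  by (rule circle.integrable_const_bound[of _ K]) (use assms in auto)

lemma continuous_cis: "continuous_on UNIV (\<lambda>t. cis t)"
  by (rule continuous_on_cis) (rule continuous_on_id)

lemma borel_measurable_cis [measurable (raw)]:
  "f \<in> borel_measurable M \<Longrightarrow> (\<lambda>x. cis (f x)) \<in> borel_measurable M"
  by (rule borel_measurable_continuous_on[OF continuous_cis])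

lemma borel_measurable_cnj [measurable (raw)]:
  "f \<in> borel_measurable M \<Longrightarrow> (\<lambda>x. cnj (f x)) \<in> borel_measurable M"
  by (rule borel_measurable_continuous_on[OF continuous_on_cnj[OF continuous_on_id]])

lemma integral_circle_cis:
  "(\<integral>t. cis t ^ m * cnj (cis t ^ n) \<partial>circle_measure) = (if m = n then 1 else 0)"
proof (cases "m = n")
  case True
  have "cis t ^ n * cnj (cis t ^ n) = 1" for t
    by (simp only: complex_norm_square[symmetric]) (simp add: norm_power)
  then show ?thesis using True measure_circle_measure by simp
next
  case False
  define k where "k = real m - real n"
  have k: "k \<noteq> 0" using False by (simp add: k_def)
  have "cis t ^ m * cnj (cis t ^ n) = cis (k * t)" for t
    by (simp only: Complex.DeMoivre complex_cnj_power cis_cnj cis_mult k_def mult_minus_right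
          mult_minus_left distrib_right diff_conv_add_uminus)
  then have "(\<integral>t. cis t ^ m * cnj (cis t ^ n) \<partial>circle_measure) = (\<integral>t. cis (k * t) \<partial>circle_measure)"
    by simp
  also have "\<dots> = (\<integral>t. (1 / (2*pi)) *\<^sub>R (indicator {0..2*pi} t *\<^sub>R cis (k * t)) \<partial>lborel)"
    unfolding circle_measure_def
    by (subst integral_density) (auto intro!: Bochner_Integration.integral_cong split: split_indicator)
  also have "\<dots> = (1 / (2*pi)) *\<^sub>R (\<integral>t. indicator {0..2*pi} t *\<^sub>R cis (k * t) \<partial>lborel)"
    by (rule integral_scaleR_right)
  also have "(\<integral>t. indicator {0..2*pi} t *\<^sub>R cis (k * t) \<partial>lborel)
      = cis (k * (2 * pi)) / (\<i> * k) - cis (k * 0) / (\<i> * k)"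
  proof (rule integral_FTC_Icc)
    fix x
    have "((\<lambda>t. exp (\<i> * of_real (k * t)) / (\<i> * k)) has_vector_derivative
            exp (\<i> * of_real (k * x))) (at x within {0..2*pi})"
      using k by (auto intro!: derivative_eq_intros has_vector_derivative_real_field simp: field_simps)
    then show "((\<lambda>t. cis (k * t) / (\<i> * k)) has_vector_derivative cis (k * x)) (at x within {0..2*pi})"
      by (simp add: cis_conv_exp)
  qed (auto intro!: continuous_intros continuous_on_cis)
  \<comment> \<open>The frequency \<open>k\<close> is an integer, so the antiderivative has period 2
    pi and the boundary terms cancel.\<close>
  also have "cis (k * (2 * pi)) = 1"
  proof -
    have "k * (2 * pi) = 2 * pi * of_int (int m - int n)" by (simp add: k_def)
    then show ?thesis by (metis cis_multiple_2pi Ints_of_int)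
  qed
  finally show ?thesis using False by simp
qed

text \<open>The conjugated series is integrated term by term, and orthonormality of the characters
  keeps only the term of index \<open>m\<close>.\<close>

lemma integral_circle_coeff:
  assumes b: "\<And>w. (\<lambda>n. b n * w ^ n) sums k w"
  shows "(\<integral>t. cis t ^ m * cnj (k (v * cis t)) \<partial>circle_measure) = cnj (b m * v ^ m)"
proof -
  define f where "f = (\<lambda>i t. cis t ^ m * cnj (b i * v ^ i * cis t ^ i))"
  have f_norm: "norm (f i t) = cmod (b i * v ^ i)" for i t
    by (simp add: f_def norm_mult norm_power)
  have [measurable]: "f i \<in> borel_measurable borel" for i
    unfolding f_def by (intro borel_measurable_continuous_onI continuous_intros continuous_cis)
  have f_int: "integrable circle_measure (f i)" for i
    by (rule integrable_circle_bounded[where K = "cmod (b i * v ^ i)"]) (measurable, simp add: f_norm)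
  have 1: "(\<Sum>i. f i t) = cis t ^ m * cnj (k (v * cis t))" for t
  proof -
    have "(\<lambda>i. cnj (b i * (v * cis t) ^ i)) sums cnj (k (v * cis t))"
      by (simp only: sums_cnj b)
    from sums_mult[OF this, of "cis t ^ m"]
    show ?thesis by (auto simp: f_def sums_iff power_mult_distrib mult_ac)
  qed
  have 2: "(\<lambda>i. integral\<^sup>L circle_measure (f i)) sums (\<integral>t. (\<Sum>i. f i t) \<partial>circle_measure)"
  proof (rule sums_integral)
    show "AE t in circle_measure. summable (\<lambda>i. norm (f i t))"
      using power_series_summable_norm[OF b] by (simp add: f_norm)
    show "summable (\<lambda>i. \<integral>t. norm (f i t) \<partial>circle_measure)"
      using power_series_summable_norm[OF b] measure_circle_measure by (simp add: f_norm)
  qed (rule f_int)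
  have 3: "integral\<^sup>L circle_measure (f i) = (if i = m then cnj (b m * v ^ m) else 0)" for i
  proof -
    have "f i = (\<lambda>t. cnj (b i * v ^ i) * (cis t ^ m * cnj (cis t ^ i)))"
      unfolding f_def by (simp add: mult_ac)
    then have "integral\<^sup>L circle_measure (f i) = cnj (b i * v ^ i) * (if m = i then 1 else 0)"
      by (simp only: integral_circle_cis integral_mult_right_zero)
    then show ?thesis by (simp split: if_splits)
  qed
  have "(\<Sum>i. if i = m then cnj (b m * v ^ m) else 0) = cnj (b m * v ^ m)"
    by (rule sums_unique[symmetric]) (rule sums_single)
  with sums_unique[OF 2] show ?thesis by (simp only: 1 3)
qed

text \<open>Only \<open>g\<close> is expanded: \<open>k\<close> is bounded on its circle, which
  dominates the series, and \<open>integral_circle_coeff\<close> evaluates each term. The points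
  \<open>u\<close> and \<open>v\<close> are independent, so that dilates of \<open>g\<close> and
  \<open>k\<close> by different factors can be compared.\<close>

lemma circle_parseval:
  assumes a: "\<And>w. (\<lambda>n. a n * w ^ n) sums g w" and b: "\<And>w. (\<lambda>n. b n * w ^ n) sums k w"
    and k: "continuous_on UNIV k"
  shows "(\<lambda>n. a n * u ^ n * cnj (b n * v ^ n)) sums
           (\<integral>t. g (u * cis t) * cnj (k (v * cis t)) \<partial>circle_measure)"
proof -
  obtain K where K: "K \<ge> 0" "\<And>w. cmod w \<le> cmod v \<Longrightarrow> cmod (k w) \<le> K"
    using continuous_bounded_on_cball[OF k, of "cmod v"] by blast
  have [measurable]: "k \<in> borel_measurable borel" using k by (rule borel_measurable_continuous_onI)
  define f where "f = (\<lambda>i t. (a i * u ^ i) * (cis t ^ i * cnj (k (v * cis t))))"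
  have [measurable]: "f i \<in> borel_measurable borel" for i unfolding f_def by measurable
  have f_norm: "norm (f i t) \<le> cmod (a i * u ^ i) * K" for i t
  proof -
    have "cmod (k (v * cis t)) \<le> K" by (rule K) (simp add: norm_mult)
    then show ?thesis by (auto simp: f_def norm_mult norm_power intro!: mult_left_mono)
  qed
  have f_int: "integrable circle_measure (f i)" for i
    by (rule integrable_circle_bounded[OF _ f_norm]) measurable
  have sm: "summable (\<lambda>i. cmod (a i * u ^ i) * K)"
    using power_series_summable_norm[OF a] by (rule summable_mult2)
  have 1: "(\<Sum>i. f i t) = g (u * cis t) * cnj (k (v * cis t))" for t
    using sums_mult2[OF a[of "u * cis t"], of "cnj (k (v * cis t))"]
    by (auto simp: f_def sums_iff power_mult_distrib mult_ac)
  have "(\<lambda>i. integral\<^sup>L circle_measure (f i)) sums (\<integral>t. (\<Sum>i. f i t) \<partial>circle_measure)"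
  proof (rule sums_integral)
    show "AE t in circle_measure. summable (\<lambda>i. norm (f i t))"
      by (rule AE_I2, rule summable_comparison_test'[OF sm]) (use f_norm in auto)
    show "summable (\<lambda>i. \<integral>t. norm (f i t) \<partial>circle_measure)"
    proof (rule summable_comparison_test'[OF sm])
      fix i
      have "(\<integral>t. norm (f i t) \<partial>circle_measure) \<le> (\<integral>t. cmod (a i * u ^ i) * K \<partial>circle_measure)"
        using f_int f_norm by (intro integral_mono) auto
      then show "norm (\<integral>t. norm (f i t) \<partial>circle_measure) \<le> cmod (a i * u ^ i) * K"
        using measure_circle_measure by simp
    qed
  qed (rule f_int)
  moreover have "integral\<^sup>L circle_measure (f i) = a i * u ^ i * cnj (b i * v ^ i)" for i
    using integral_circle_coeff[OF b, of i v] by (simp add: f_def)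
  ultimately show ?thesis by (simp add: 1)
qed

subsection \<open>Rotations and the Gaussian measure\<close>

lemma nn_integral_lborel_translate:
  assumes [measurable]: "f \<in> borel_measurable borel"
  shows "(\<integral>\<^sup>+x. f (c + x) \<partial>lborel) = (\<integral>\<^sup>+x. f x \<partial>(lborel :: 'a::euclidean_space measure))"
proof -
  have "(\<integral>\<^sup>+x. f x \<partial>lborel) = (\<integral>\<^sup>+x. f x \<partial>distr lborel borel ((+) c))"
    by (simp add: lborel_distr_plus)
  also have "\<dots> = (\<integral>\<^sup>+x. f (c + x) \<partial>lborel)"
    by (subst nn_integral_distr) auto
  finally show ?thesis by simp
qed

text \<open>Uniqueness of Haar measure: integrate \<open>f (c x + y)\<close> over \<open>y\<close> in the unit ball,
  in both orders.\<close>

lemma nn_integral_lborel_rotate: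
  fixes f :: "complex \<Rightarrow> ennreal"
  assumes f[measurable]: "f \<in> borel_measurable borel" and c: "cmod c = 1"
  shows "(\<integral>\<^sup>+x. f (c * x) \<partial>lborel) = (\<integral>\<^sup>+x. f x \<partial>lborel)"
proof -
  let ?B = "ball 0 1 :: complex set"
  define h :: "complex \<Rightarrow> ennreal" where "h = indicator ?B"
  have [measurable]: "h \<in> borel_measurable borel"
    unfolding h_def by (rule borel_measurable_indicator) simp
  let ?m = "emeasure lborel ?B"
  have c0: "c \<noteq> 0" using c by auto
  have "(\<integral>\<^sup>+x. f (c * x) \<partial>lborel) * ?m =
        (\<integral>\<^sup>+y. (\<integral>\<^sup>+x. f (c * x) \<partial>lborel) * h y \<partial>lborel)"
    unfolding h_def by (rule nn_integral_cmult_indicator[symmetric]) simp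
  also have "\<dots> = (\<integral>\<^sup>+y. (\<integral>\<^sup>+x. f (c * x + y) * h y \<partial>lborel) \<partial>lborel)"
  proof (rule nn_integral_cong)
    fix y
    have "(\<integral>\<^sup>+x. f (c * x) \<partial>lborel) = (\<integral>\<^sup>+x. f (c * (y / c + x)) \<partial>lborel)"
      by (rule nn_integral_lborel_translate[symmetric]) measurable
    also have "\<dots> = (\<integral>\<^sup>+x. f (c * x + y) \<partial>lborel)"
      using c0 by (simp add: algebra_simps)
    finally show "(\<integral>\<^sup>+x. f (c * x) \<partial>lborel) * h y =
        (\<integral>\<^sup>+x. f (c * x + y) * h y \<partial>lborel)"
      by (simp add: nn_integral_multc)
  qed
  also have "\<dots> = (\<integral>\<^sup>+x. (\<integral>\<^sup>+y. f (c * x + y) * h y \<partial>lborel) \<partial>lborel)"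
    by (rule lborel_pair.Fubini') measurable
  also have "\<dots> = (\<integral>\<^sup>+x. (\<integral>\<^sup>+y. f y * h (y - c * x) \<partial>lborel) \<partial>lborel)"
  proof (rule nn_integral_cong)
    fix x
    have "(\<integral>\<^sup>+y. f (c * x + y) * h ((c * x + y) - c * x) \<partial>lborel) =
          (\<integral>\<^sup>+y. f y * h (y - c * x) \<partial>lborel)"
      by (rule nn_integral_lborel_translate[of "\<lambda>y. f y * h (y - c * x)"]) measurable
    then show "(\<integral>\<^sup>+y. f (c * x + y) * h y \<partial>lborel) =
               (\<integral>\<^sup>+y. f y * h (y - c * x) \<partial>lborel)" by simp
  qed
  also have "\<dots> = (\<integral>\<^sup>+y. (\<integral>\<^sup>+x. f y * h (y - c * x) \<partial>lborel) \<partial>lborel)"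
    by (rule lborel_pair.Fubini') measurable
  also have "\<dots> = (\<integral>\<^sup>+y. f y * ?m \<partial>lborel)"
  proof (rule nn_integral_cong)
    fix y
    \<comment> \<open>Translating \<open>x\<close> by \<open>y / c\<close> centres the ball at 0,
      and multiplication by \<open>- c\<close>, of modulus 1, leaves the unit ball
      invariant.\<close>
    have "y - c * (y / c + x) = - (c * x)" for x
      using c0 by (simp add: field_simps)
    then have "h (y - c * (y / c + x)) = h x" for x
      using c by (simp add: h_def indicator_def norm_mult)
    then have "(\<integral>\<^sup>+x. h (y - c * (y / c + x)) \<partial>lborel) = ?m"
      by (simp add: h_def)
    moreover have "(\<integral>\<^sup>+x. h (y - c * (y / c + x)) \<partial>lborel) =
        (\<integral>\<^sup>+x. h (y - c * x) \<partial>lborel)"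
      by (rule nn_integral_lborel_translate) measurable
    ultimately show "(\<integral>\<^sup>+x. f y * h (y - c * x) \<partial>lborel) = f y * ?m"
      by (simp add: nn_integral_cmult)
  qed
  also have "\<dots> = (\<integral>\<^sup>+y. f y \<partial>lborel) * ?m"
    by (simp add: nn_integral_multc)
  finally have "(\<integral>\<^sup>+x. f (c * x) \<partial>lborel) * ?m = (\<integral>\<^sup>+y. f y \<partial>lborel) * ?m" .
  \<comment> \<open>The volume of the ball is positive and finite, so it can be cancelled in
    \<open>ennreal\<close>.\<close>
  moreover have "?m \<noteq> 0"
    using open_not_negligible[of ?B] by (auto simp: negligible_iff_emeasure0)
  moreover have "?m \<noteq> \<infinity>"
    using emeasure_lborel_ball_finite[of "0::complex" 1] by simp
  ultimately show ?thesis
    by (simp add: mult.commute[of _ ?m] ennreal_mult_cancel_left)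
qed

text \<open>Tonelli turns finiteness of the iterated integral of the modulus into integrability on
  the product.\<close>

lemma Fubini_complex:
  fixes f :: "'a \<Rightarrow> 'b \<Rightarrow> complex"
  assumes "sigma_finite_measure M" "sigma_finite_measure N"
    and [measurable]: "case_prod f \<in> borel_measurable (M \<Otimes>\<^sub>M N)"
    and fin: "(\<integral>\<^sup>+y. (\<integral>\<^sup>+x. ennreal (cmod (f x y)) \<partial>M) \<partial>N) < \<infinity>"
  shows "(\<integral>y. (\<integral>x. f x y \<partial>M) \<partial>N) = (\<integral>x. (\<integral>y. f x y \<partial>N) \<partial>M)"
proof -
  interpret M: sigma_finite_measure M by fact
  interpret N: sigma_finite_measure N by fact
  interpret pair_sigma_finite M N ..
  have "integrable (M \<Otimes>\<^sub>M N) (case_prod f)"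
  proof (rule integrableI_bounded)
    have "(\<integral>\<^sup>+p. ennreal (norm (case_prod f p)) \<partial>(M \<Otimes>\<^sub>M N)) =
          (\<integral>\<^sup>+y. (\<integral>\<^sup>+x. ennreal (norm (case_prod f (x, y))) \<partial>M) \<partial>N)"
      by (rule nn_integral_snd[symmetric]) measurable
    with fin show "(\<integral>\<^sup>+p. ennreal (norm (case_prod f p)) \<partial>(M \<Otimes>\<^sub>M N)) < \<infinity>"
      by simp
  qed measurable
  then show ?thesis by (rule Fubini_integral)
qed

section \<open>Moments of the Gaussian measure\<close>

lemma sets_gauss [measurable_cong, simp]: "sets gauss = sets borel"
  by (simp add: gauss_def)

lemma space_gauss [simp]: "space gauss = UNIV"
  by (simp add: gauss_def)

lemma nn_integral_gauss:
  assumes [measurable]: "f \<in> borel_measurable borel"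
  shows "(\<integral>\<^sup>+z. f z \<partial>gauss) = (\<integral>\<^sup>+z. ennreal (exp (- (cmod z)\<^sup>2) / pi) * f z \<partial>lborel)"
  unfolding gauss_def by (rule nn_integral_density) measurable

text \<open>A single term of the exponential series is at most the sum, as all terms are
  nonnegative.\<close>

lemma power_le_fact_mult_exp:
  fixes x :: real
  assumes "x \<ge> 0"
  shows "x ^ n \<le> fact n * exp x"
proof -
  have "summable (\<lambda>k. inverse (fact k) *\<^sub>R x ^ k)" by (rule summable_exp_generic)
  then have "(\<Sum>k\<in>{n}. inverse (fact k) *\<^sub>R x ^ k) \<le> (\<Sum>k. inverse (fact k) *\<^sub>R x ^ k)"
    by (rule sum_le_suminf) (use assms in auto)
  then show ?thesis by (simp add: exp_def field_simps)
qed

text \<open>On the annulus \<open>j \<le> \<bar>z\<bar> < j + 1\<close> the integrand is \<open>O(j\<^sup>-\<^sup>4)\<close>, and the disc of radius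
  \<open>j + 1\<close> has area \<open>O(j\<^sup>2)\<close>.\<close>

lemma nn_integral_gauss_power_finite: "(\<integral>\<^sup>+z. ennreal (cmod z ^ n) \<partial>gauss) < \<infinity>"
proof -
  \<comment> \<open>The exponent \<open>n + 4\<close> pays for \<open>r ^ n\<close> and four extra
    powers: two absorb the area of the disc, two leave a summable series. The factor
    \<open>exp 2\<close> bounds \<open>exp (r + 1 - r\<^sup>2)\<close>, and \<open>pi\<close> comes
    from the density.\<close>
  define K :: real where "K = fact (n + 4) * exp 2 / pi"
  have K: "exp (- r\<^sup>2) / pi * r ^ n \<le> K / (real j + 1) ^ 4"
    if r: "real j \<le> r" for r :: real and j :: nat
  proof -
    have "r ^ n * (real j + 1) ^ 4 \<le> (r + 1) ^ n * (r + 1) ^ 4"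
      using r by (intro mult_mono power_mono) auto
    also have "\<dots> = (r + 1) ^ (n + 4)" by (simp add: power_add)
    also have "\<dots> \<le> fact (n + 4) * exp (r + 1)"
      using r by (intro power_le_fact_mult_exp) auto
    finally have "exp (- r\<^sup>2) * (r ^ n * (real j + 1) ^ 4) \<le> exp (- r\<^sup>2) * (fact (n + 4) * exp (r + 1))"
      by (intro mult_left_mono) auto
    also have "\<dots> = fact (n + 4) * exp (r + 1 - r\<^sup>2)" by (simp add: exp_diff exp_minus field_simps)
    also have "\<dots> \<le> fact (n + 4) * exp 2"
    proof -
      \<comment> \<open>Completing the square: r + 1 - r^2 is at most 5/4.\<close>
      have "0 \<le> (r - 1/2)\<^sup>2" by simp
      then have "r + 1 - r\<^sup>2 \<le> 2" by (simp add: power2_eq_square algebra_simps)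
      then show ?thesis by simp
    qed
    finally have "exp (- r\<^sup>2) * (r ^ n * (real j + 1) ^ 4) / pi \<le> K"
      unfolding K_def by (intro divide_right_mono) auto
    moreover have "(real j + 1) ^ 4 > 0" by simp
    ultimately show ?thesis by (simp add: pos_le_divide_eq mult_ac del: zero_less_power)
  qed
  have K0: "K \<ge> 0" by (simp add: K_def)
  have "(\<integral>\<^sup>+z. ennreal (cmod z ^ n) \<partial>gauss) =
      (\<integral>\<^sup>+z. ennreal (exp (- (cmod z)\<^sup>2) / pi * cmod z ^ n) \<partial>lborel)"
    by (subst nn_integral_gauss) (auto simp: ennreal_mult[symmetric] intro!: nn_integral_cong)
  also have "\<dots> \<le> (\<integral>\<^sup>+z. (\<Sum>j. ennreal (K / (real j + 1) ^ 4) * indicator (ball (0::complex) (real j + 1)) z) \<partial>lborel)"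
  proof (rule nn_integral_mono)
    fix z :: complex
    define j where "j = nat \<lfloor>cmod z\<rfloor>"
    have j: "real j \<le> cmod z" "cmod z < real j + 1" 
      using real_of_int_floor_add_one_gt[of "cmod z"] by (auto simp: j_def)
    have "ennreal (exp (- (cmod z)\<^sup>2) / pi * cmod z ^ n) \<le>
          ennreal (K / (real j + 1) ^ 4) * indicator (ball 0 (real j + 1)) z"
      using K[OF j(1)] j(2) by (simp add: ennreal_leI)
    also have "\<dots> \<le> (\<Sum>j. ennreal (K / (real j + 1) ^ 4) * indicator (ball 0 (real j + 1)) z)"
    proof -
      have "h j \<le> suminf h" for h :: "nat \<Rightarrow> ennreal"
        using sum_le_suminf[of h "{j}"] by simp
      then show ?thesis .
    qed
    finally show "ennreal (exp (- (cmod z)\<^sup>2) / pi * cmod z ^ n) \<le> \<dots>" .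
  qed
  also have "\<dots> = (\<Sum>j. ennreal (K / (real j + 1) ^ 4) * emeasure lborel (ball 0 (real j + 1) :: complex set))"
    by (subst nn_integral_suminf)
      (auto simp: nn_integral_cmult_indicator intro!: borel_measurable_times_ennreal borel_measurable_indicator)
  also have "\<dots> = (\<Sum>j. ennreal (K * unit_ball_vol 2 * inverse (real (Suc j) ^ 2)))"
  proof (rule suminf_cong)
    fix j
    define x where "x = real j + 1"
    have "x > 0" by (simp add: x_def)
    then have "K / x ^ 4 * (unit_ball_vol 2 * x ^ 2) = K * unit_ball_vol 2 * inverse (x ^ 2)"
      by (simp add: field_simps power4_eq_xxxx power2_eq_square)
    moreover have "ennreal (K / x ^ 4) * emeasure lborel (ball 0 x :: complex set) =
        ennreal (K / x ^ 4 * (unit_ball_vol 2 * x ^ 2))"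
      using K0 \<open>x > 0\<close> by (subst ennreal_mult) (auto simp: emeasure_ball)
    ultimately show "ennreal (K / (real j + 1) ^ 4) * emeasure lborel (ball 0 (real j + 1) :: complex set) =
        ennreal (K * unit_ball_vol 2 * inverse (real (Suc j) ^ 2))"
      by (simp add: x_def add.commute)
  qed
  also have "\<dots> < \<infinity>"
  proof -
    have "summable (\<lambda>j. inverse (real (Suc j) ^ 2))"
      by (subst summable_Suc_iff) (rule inverse_power_summable, simp)
    then have "summable (\<lambda>j. K * unit_ball_vol 2 * inverse (real (Suc j) ^ 2))"
      by (rule summable_mult)
    moreover have "K * unit_ball_vol 2 * inverse (real (Suc j) ^ 2) \<ge> 0" for j
      using K0 by simp
    ultimately show ?thesis using ennreal_suminf_neq_top by (simp add: less_top)
  qed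
  finally show ?thesis .
qed

interpretation gauss: finite_measure gauss
  using nn_integral_gauss_power_finite[of 0] by (intro finite_measureI) (simp add: less_top)

section \<open>Rotation invariance of the Gaussian measure\<close>

lemma nn_integral_gauss_rotate:
  assumes [measurable]: "f \<in> borel_measurable borel" and c: "cmod c = 1"
  shows "(\<integral>\<^sup>+z. f (c * z) \<partial>gauss) = (\<integral>\<^sup>+z. f z \<partial>gauss)"
proof -
  have "(\<integral>\<^sup>+z. f (c * z) \<partial>gauss) = (\<integral>\<^sup>+z. ennreal (exp (- (cmod (c * z))\<^sup>2) / pi) * f (c * z) \<partial>lborel)"
    using c by (subst nn_integral_gauss) (auto simp: norm_mult)
  also have "\<dots> = (\<integral>\<^sup>+z. ennreal (exp (- (cmod z)\<^sup>2) / pi) * f z \<partial>lborel)"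
    by (rule nn_integral_lborel_rotate[OF _ c]) measurable
  also have "\<dots> = (\<integral>\<^sup>+z. f z \<partial>gauss)" by (subst nn_integral_gauss) auto
  finally show ?thesis .
qed

text \<open>Invariance as an equality of measures carries over to Bochner integrals.\<close>

lemma distr_gauss_rotate:
  assumes c: "cmod c = 1"
  shows "distr gauss borel ((*) c) = gauss"
proof (rule measure_eqI)
  fix A assume "A \<in> sets (distr gauss borel ((*) c))"
  then have [measurable]: "A \<in> sets borel" by simp
  have "emeasure (distr gauss borel ((*) c)) A = (\<integral>\<^sup>+z. indicator A z \<partial>distr gauss borel ((*) c))"
    by simp
  also have "\<dots> = (\<integral>\<^sup>+z. indicator A (c * z) \<partial>gauss)"
    by (rule nn_integral_distr) measurable
  also have "\<dots> = (\<integral>\<^sup>+z. indicator A z \<partial>gauss)"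
    by (rule nn_integral_gauss_rotate[OF _ c]) measurable
  finally show "emeasure (distr gauss borel ((*) c)) A = emeasure gauss A" by simp
qed simp

lemma integral_gauss_rotate:
  fixes f :: "complex \<Rightarrow> complex"
  assumes [measurable]: "f \<in> borel_measurable borel" and c: "cmod c = 1"
  shows "(\<integral>z. f (c * z) \<partial>gauss) = (\<integral>z. f z \<partial>gauss)"
  using integral_distr[of "(*) c" gauss borel f] by (simp add: distr_gauss_rotate[OF c])

text \<open>Tonelli and rotation invariance. Comparisons of Gaussian integrals thereby reduce to
  comparisons of circle means.\<close>

lemma nn_integral_gauss_circle:
  assumes [measurable]: "f \<in> borel_measurable borel"
  shows "(\<integral>\<^sup>+z. (\<integral>\<^sup>+t. f (z * cis t) \<partial>circle_measure) \<partial>gauss) = (\<integral>\<^sup>+z. f z \<partial>gauss)"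
proof -
  interpret pair_sigma_finite circle_measure gauss ..
  have "(\<integral>\<^sup>+z. (\<integral>\<^sup>+t. f (z * cis t) \<partial>circle_measure) \<partial>gauss) =
        (\<integral>\<^sup>+t. (\<integral>\<^sup>+z. f (z * cis t) \<partial>gauss) \<partial>circle_measure)"
    by (rule Fubini') measurable
  also have "\<dots> = (\<integral>\<^sup>+t. (\<integral>\<^sup>+z. f z \<partial>gauss) \<partial>circle_measure)"
    using nn_integral_gauss_rotate[of f "cis t" for t] by (simp add: mult.commute)
  finally show ?thesis by (simp add: emeasure_circle_measure)
qed

lemma integral_gauss_circle:
  fixes f :: "complex \<Rightarrow> complex"
  assumes f: "integrable gauss f"
  shows "(\<integral>z. (\<integral>t. f (z * cis t) \<partial>circle_measure) \<partial>gauss) = (\<integral>z. f z \<partial>gauss)"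
proof -
  have [measurable]: "f \<in> borel_measurable borel"
    using borel_measurable_integrable[OF f] by simp
  have "(\<integral>z. (\<integral>t. f (z * cis t) \<partial>circle_measure) \<partial>gauss) =
        (\<integral>t. (\<integral>z. f (z * cis t) \<partial>gauss) \<partial>circle_measure)"
  proof (rule Fubini_complex)
    have "(\<integral>\<^sup>+z. (\<integral>\<^sup>+t. ennreal (cmod (f (z * cis t))) \<partial>circle_measure) \<partial>gauss) =
          (\<integral>\<^sup>+z. ennreal (cmod (f z)) \<partial>gauss)"
      by (rule nn_integral_gauss_circle) measurable
    also have "\<dots> < \<infinity>" using f by (simp add: integrable_iff_bounded)
    finally show "(\<integral>\<^sup>+z. (\<integral>\<^sup>+t. ennreal (cmod (f (z * cis t))) \<partial>circle_measure) \<partial>gauss) < \<infinity>" .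
  qed (auto intro: circle.sigma_finite_measure_axioms gauss.sigma_finite_measure_axioms)
  also have "\<dots> = (\<integral>t. (\<integral>z. f z \<partial>gauss) \<partial>circle_measure)"
    using integral_gauss_rotate[of f "cis t" for t] by (simp add: mult.commute)
  finally show ?thesis by simp
qed

subsection \<open>Dilations on the Fock space\<close>

lemma circle_parseval_norm:
  assumes a: "\<And>w. (\<lambda>n. a n * w ^ n) sums g w" and g: "continuous_on UNIV g"
  shows "(\<lambda>n. (cmod (a n * u ^ n))\<^sup>2) sums (\<integral>t. (cmod (g (u * cis t)))\<^sup>2 \<partial>circle_measure)"
proof -
  have "(\<lambda>n. complex_of_real ((cmod (a n * u ^ n))\<^sup>2)) sums
          complex_of_real (\<integral>t. (cmod (g (u * cis t)))\<^sup>2 \<partial>circle_measure)"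
    using circle_parseval[OF a a g, of u u]
    by (simp only: complex_norm_square integral_complex_of_real[symmetric])
  then show ?thesis by (simp only: sums_of_real_iff)
qed

text \<open>By Parseval the mean is the sum of the |a_n u^n|^2, and dilation multiplies the n-th
  summand by s^(2n) \<le> 1.\<close>

lemma circle_mean_mono:
  assumes g: "g holomorphic_on UNIV" and s: "0 \<le> s" "s \<le> 1"
  shows "(\<integral>t. (cmod (g (of_real s * u * cis t)))\<^sup>2 \<partial>circle_measure) \<le>
         (\<integral>t. (cmod (g (u * cis t)))\<^sup>2 \<partial>circle_measure)"
proof -
  obtain a where a: "\<And>w. (\<lambda>n. a n * w ^ n) sums g w" using entire_power_series[OF g] by blast
  have g': "continuous_on UNIV g" using g by (rule holomorphic_on_imp_continuous_on)
  show ?thesis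
  proof (rule sums_le[OF _ circle_parseval_norm[OF a g'] circle_parseval_norm[OF a g']])
    fix n
    have "s ^ n * cmod (a n * u ^ n) \<le> 1 * cmod (a n * u ^ n)"
      using s by (intro mult_right_mono power_le_one) auto
    moreover have "cmod (a n * (of_real s * u) ^ n) = s ^ n * cmod (a n * u ^ n)"
      using s by (simp add: norm_mult norm_power power_mult_distrib mult_ac)
    ultimately have "cmod (a n * (of_real s * u) ^ n) \<le> cmod (a n * u ^ n)" by simp
    then show "(cmod (a n * (of_real s * u) ^ n))\<^sup>2 \<le> (cmod (a n * u ^ n))\<^sup>2"
      by (rule power_mono) simp
  qed
qed

lemma FockD:
  assumes "f \<in> Fock"
  shows "f holomorphic_on UNIV" "continuous_on UNIV f" "f \<in> borel_measurable borel"
    "integrable gauss (\<lambda>z. (cmod (f z))\<^sup>2)"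
  using assms by (auto simp: Fock_def L2_gauss_def holomorphic_on_imp_continuous_on)

lemma integrable_circle_continuous:
  fixes f :: "complex \<Rightarrow> 'a::{banach,second_countable_topology}"
  assumes f: "continuous_on UNIV f"
  shows "integrable circle_measure (\<lambda>t. f (u * cis t))"
proof -
  obtain K where K: "K \<ge> 0" "\<And>w. cmod w \<le> cmod u \<Longrightarrow> norm (f w) \<le> K"
    using continuous_bounded_on_cball[OF f, of "cmod u"] by blast
  have [measurable]: "f \<in> borel_measurable borel" using f by (rule borel_measurable_continuous_onI)
  show ?thesis
    by (rule integrable_circle_bounded[OF _ K(2)]) (auto simp: norm_mult)
qed

text \<open>The circle means compare by \<open>circle_mean_mono\<close>, and averaging over
  rotations preserves both integrals. In terms of nonnegative integrals the bound serves to prove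
  square integrability as well as to estimate norms.\<close>

lemma nn_integral_dilate_le:
  assumes g: "g holomorphic_on UNIV" and s: "0 \<le> s" "s \<le> 1"
  shows "(\<integral>\<^sup>+z. ennreal ((cmod (g (of_real s * z)))\<^sup>2) \<partial>gauss) \<le> (\<integral>\<^sup>+z. ennreal ((cmod (g z))\<^sup>2) \<partial>gauss)"
proof -
  have g': "continuous_on UNIV g" using g by (rule holomorphic_on_imp_continuous_on)
  then have [measurable]: "g \<in> borel_measurable borel" by (rule borel_measurable_continuous_onI)
  have g2: "continuous_on UNIV (\<lambda>w. (cmod (g w))\<^sup>2)"
    using g' by (intro continuous_intros)
  have "(\<integral>\<^sup>+z. ennreal ((cmod (g (of_real s * z)))\<^sup>2) \<partial>gauss) =
      (\<integral>\<^sup>+z. (\<integral>\<^sup>+t. ennreal ((cmod (g (of_real s * (z * cis t))))\<^sup>2) \<partial>circle_measure) \<partial>gauss)"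
    by (rule nn_integral_gauss_circle[symmetric]) measurable
  also have "\<dots> \<le> (\<integral>\<^sup>+z. (\<integral>\<^sup>+t. ennreal ((cmod (g (z * cis t)))\<^sup>2) \<partial>circle_measure) \<partial>gauss)"
  proof (rule nn_integral_mono)
    fix z
    show "(\<integral>\<^sup>+t. ennreal ((cmod (g (of_real s * (z * cis t))))\<^sup>2) \<partial>circle_measure) \<le>
          (\<integral>\<^sup>+t. ennreal ((cmod (g (z * cis t)))\<^sup>2) \<partial>circle_measure)"
      using circle_mean_mono[OF g s, of z] integrable_circle_continuous[OF g2, of "of_real s * z"]
        integrable_circle_continuous[OF g2, of z]
      by (simp add: nn_integral_eq_integral mult.assoc[symmetric] ennreal_leI)
  qed
  also have "\<dots> = (\<integral>\<^sup>+z. ennreal ((cmod (g z))\<^sup>2) \<partial>gauss)"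
    by (rule nn_integral_gauss_circle) measurable
  finally show ?thesis .
qed

lemma FockI:
  assumes "f holomorphic_on UNIV" "(\<integral>\<^sup>+z. ennreal ((cmod (f z))\<^sup>2) \<partial>gauss) < \<infinity>"
  shows "f \<in> Fock"
proof -
  have [measurable]: "f \<in> borel_measurable borel"
    using assms(1) by (intro borel_measurable_continuous_onI holomorphic_on_imp_continuous_on)
  have "integrable gauss (\<lambda>z. (cmod (f z))\<^sup>2)"
    by (rule integrableI_bounded) (use assms(2) in auto)
  then show ?thesis using assms(1) by (simp add: Fock_def L2_gauss_def)
qed

lemma Fock_nn_integral:
  assumes "f \<in> Fock"
  shows "(\<integral>\<^sup>+z. ennreal ((cmod (f z))\<^sup>2) \<partial>gauss) = ennreal ((norm_gauss f)\<^sup>2)"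
  using FockD(4)[OF assms] by (simp add: nn_integral_eq_integral norm_gauss_def)

lemma norm_gauss_nonneg [simp]: "norm_gauss f \<ge> 0"
  by (simp add: norm_gauss_def)

lemma Fock_dilate:
  assumes g: "g \<in> Fock" and s: "0 \<le> s" "s \<le> 1"
  shows "(\<lambda>z. g (of_real s * z)) \<in> Fock"
proof (rule FockI)
  show "(\<lambda>z. g (of_real s * z)) holomorphic_on UNIV"
    using holomorphic_on_compose_gen[of "\<lambda>z. of_real s * z" UNIV g UNIV] FockD(1)[OF g]
    by (auto simp: o_def intro!: holomorphic_intros)
  show "(\<integral>\<^sup>+z. ennreal ((cmod (g (of_real s * z)))\<^sup>2) \<partial>gauss) < \<infinity>"
    using nn_integral_dilate_le[OF FockD(1)[OF g] s] Fock_nn_integral[OF g]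
    by (simp add: order_le_less_trans)
qed

text \<open>The product is dominated by the sum of the squares, since 2xy \<le> x^2 + y^2.\<close>

lemma L2_mult_integrable:
  assumes f: "f \<in> borel_measurable borel" "integrable gauss (\<lambda>z. (cmod (f z))\<^sup>2)"
    and g: "g \<in> borel_measurable borel" "integrable gauss (\<lambda>z. (cmod (g z))\<^sup>2)"
  shows "integrable gauss (\<lambda>z. f z * cnj (g z))"
proof (rule Bochner_Integration.integrable_bound)
  show "integrable gauss (\<lambda>z. (cmod (f z))\<^sup>2 + (cmod (g z))\<^sup>2)"
    using f g by (intro Bochner_Integration.integrable_add)
  have "cmod (f z) * cmod (g z) \<le> (cmod (f z))\<^sup>2 + (cmod (g z))\<^sup>2" for z
  proof -
    have "0 \<le> cmod (f z) * cmod (g z)" by simp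
    with sum_squares_bound[of "cmod (f z)" "cmod (g z)"] show ?thesis by linarith
  qed
  then show "AE z in gauss. norm (f z * cnj (g z)) \<le> norm ((cmod (f z))\<^sup>2 + (cmod (g z))\<^sup>2)"
    by (simp add: norm_mult)
qed (use f g in measurable)

lemma Fock_mult_integrable:
  assumes "f \<in> Fock" "g \<in> Fock"
  shows "integrable gauss (\<lambda>z. f z * cnj (g z))"
  using assms FockD by (intro L2_mult_integrable) auto

text \<open>Both sides have the same mean over every circle about the origin.\<close>

lemma inner_gauss_dilate:
  assumes g: "g \<in> Fock" and k: "k \<in> Fock" and s: "0 \<le> s" "s \<le> 1"
  shows "inner_gauss (\<lambda>z. g (of_real s * z)) (\<lambda>z. k (of_real s * z)) =
         inner_gauss (\<lambda>z. g (of_real (s\<^sup>2) * z)) k"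
proof -
  have s2: "0 \<le> s\<^sup>2" "s\<^sup>2 \<le> 1" using s by (auto simp: power_le_one)
  obtain a where a: "\<And>w. (\<lambda>n. a n * w ^ n) sums g w"
    using entire_power_series[OF FockD(1)[OF g]] by blast
  obtain b where b: "\<And>w. (\<lambda>n. b n * w ^ n) sums k w"
    using entire_power_series[OF FockD(1)[OF k]] by blast
  have *: "(\<integral>t. g (of_real s * z * cis t) * cnj (k (of_real s * z * cis t)) \<partial>circle_measure) =
        (\<integral>t. g (of_real (s\<^sup>2) * z * cis t) * cnj (k (z * cis t)) \<partial>circle_measure)" for z
  proof (rule sums_unique2[OF circle_parseval[OF a b FockD(2)[OF k]]])
    \<comment> \<open>Since \<open>s\<close> is real, a factor \<open>s ^ n\<close> passes through
      the conjugation from \<open>k\<close> to \<open>g\<close>, so both Parseval series have the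
      same terms.\<close>
    have "a n * (of_real (s\<^sup>2) * z) ^ n * cnj (b n * z ^ n) =
          a n * (of_real s * z) ^ n * cnj (b n * (of_real s * z) ^ n)" for n
      by (simp add: power_mult_distrib power2_eq_square)
    with circle_parseval[OF a b FockD(2)[OF k], of "of_real (s\<^sup>2) * z" z]
    show "(\<lambda>n. a n * (of_real s * z) ^ n * cnj (b n * (of_real s * z) ^ n)) sums
       (\<integral>t. g (of_real (s\<^sup>2) * z * cis t) * cnj (k (z * cis t)) \<partial>circle_measure)"
      by (simp only:)
  qed
  have "inner_gauss (\<lambda>z. g (of_real s * z)) (\<lambda>z. k (of_real s * z)) =
     (\<integral>z. (\<integral>t. g (of_real s * (z * cis t)) * cnj (k (of_real s * (z * cis t))) \<partial>circle_measure) \<partial>gauss)"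
    unfolding inner_gauss_def using Fock_mult_integrable[OF Fock_dilate[OF g s] Fock_dilate[OF k s]]
    by (rule integral_gauss_circle[symmetric])
  also have "\<dots> = (\<integral>z. (\<integral>t. g (of_real (s\<^sup>2) * (z * cis t)) * cnj (k (z * cis t)) \<partial>circle_measure) \<partial>gauss)"
    using * by (simp only: mult.assoc)
  also have "\<dots> = inner_gauss (\<lambda>z. g (of_real (s\<^sup>2) * z)) k"
    unfolding inner_gauss_def using Fock_mult_integrable[OF Fock_dilate[OF g s2] k]
    by (rule integral_gauss_circle)
  finally show ?thesis .
qed

text \<open>The Gaussian density is positive, so \<open>f\<close> vanishes Lebesgue almost
  everywhere; its zero set is closed and of full measure, hence the whole plane.\<close>

lemma Fock_eq_0:
  assumes f: "f \<in> Fock" and n: "norm_gauss f = 0"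
  shows "f = (\<lambda>_. 0)"
proof -
  note [measurable] = FockD(3)[OF f]
  have "(\<integral>z. (cmod (f z))\<^sup>2 \<partial>gauss) = 0" using n by (simp add: norm_gauss_def)
  then have "AE z in gauss. (cmod (f z))\<^sup>2 = 0"
    using integral_nonneg_eq_0_iff_AE[OF FockD(4)[OF f]] by simp
  then have "AE z in lborel. f z = 0"
    unfolding gauss_def by (subst (asm) AE_density) auto
  then have "AE z in lebesgue. z \<in> {z. f z = 0}"
    by (simp add: AE_completion)
  moreover have "closed {z. f z = 0}"
    by (rule closed_Collect_eq[OF FockD(2)[OF f] continuous_on_const])
  ultimately show ?thesis using mem_closed_if_AE_lebesgue[of "{z. f z = 0}"] by auto
qed

subsection \<open>Averages of dilations\<close>

definition dilation_average :: "real measure \<Rightarrow> fun_op" where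
  "dilation_average \<sigma> f z = (\<integral>s. f (of_real s * z) \<partial>\<sigma>)"

text \<open>The measure lives on the whole Borel line and is concentrated on (0, 1] only almost
  everywhere, so that the image under \<open>1 / t\<close> and restrictions by indicator densities
  are instances.\<close>

locale dilation_measure = finite_measure \<sigma> for \<sigma> :: "real measure" +
  assumes sets_\<sigma> [measurable_cong, simp]: "sets \<sigma> = sets borel"
    and AE_\<sigma>: "AE s in \<sigma>. 0 < s \<and> s \<le> 1"
begin

lemma space_\<sigma> [simp]: "space \<sigma> = UNIV"
  using sets_eq_imp_space_eq[OF sets_\<sigma>] by simp

text \<open>A continuous \<open>f\<close> is bounded on the closed disc of radius |z|, which
  contains \<open>of_real s * z\<close> for almost every \<open>s\<close>, and
  \<open>\<sigma>\<close> is finite.\<close>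

lemma integrable_dilation:
  fixes f :: "complex \<Rightarrow> 'b::{banach,second_countable_topology}"
  assumes f: "continuous_on UNIV f"
  shows "integrable \<sigma> (\<lambda>s. f (of_real s * z))"
proof -
  obtain K where K: "K \<ge> 0" "\<And>w. cmod w \<le> cmod z \<Longrightarrow> norm (f w) \<le> K"
    using continuous_bounded_on_cball[OF f, of "cmod z"] by blast
  have [measurable]: "f \<in> borel_measurable borel" using f by (rule borel_measurable_continuous_onI)
  show ?thesis
  proof (rule integrable_const_bound[where B = K])
    show "AE s in \<sigma>. norm (f (of_real s * z)) \<le> K"
      using AE_\<sigma> by eventually_elim (intro K, simp add: norm_mult mult_left_le_one_le)
  qed measurable
qed

text \<open>Integrating the Taylor series term by term multiplies the n-th coefficient by the n-th
  moment of \<open>\<sigma>\<close>; the resulting power series converges everywhere.\<close>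

lemma holomorphic_dilation_average:
  assumes f: "f holomorphic_on UNIV"
  shows "dilation_average \<sigma> f holomorphic_on UNIV"
proof -
  obtain a where a: "\<And>w. (\<lambda>n. a n * w ^ n) sums f w" using entire_power_series[OF f] by blast
  have pow: "integrable \<sigma> (\<lambda>s. a n * (of_real s * z) ^ n)" for n z
    by (rule integrable_dilation) (intro continuous_intros)
  have "(\<lambda>n. (a n * (\<integral>s. complex_of_real s ^ n \<partial>\<sigma>)) * z ^ n) sums dilation_average \<sigma> f z" for z
  proof -
    have AE_le: "AE s in \<sigma>. norm (a n * (of_real s * z) ^ n) \<le> cmod (a n * z ^ n)" for n
      using AE_\<sigma>
      by eventually_elim
        (auto simp: norm_mult norm_power power_mult_distrib mult_left_le_one_le power_le_one
          intro!: mult_left_mono)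
    have sm: "summable (\<lambda>n. cmod (a n * z ^ n))" by (rule power_series_summable_norm[OF a])
    have "(\<lambda>n. \<integral>s. a n * (of_real s * z) ^ n \<partial>\<sigma>) sums (\<integral>s. (\<Sum>n. a n * (of_real s * z) ^ n) \<partial>\<sigma>)"
    proof (rule sums_integral[OF pow])
      show "AE s in \<sigma>. summable (\<lambda>n. norm (a n * (of_real s * z) ^ n))"
        using power_series_summable_norm[OF a] by simp
      show "summable (\<lambda>n. \<integral>s. norm (a n * (of_real s * z) ^ n) \<partial>\<sigma>)"
      proof (rule summable_comparison_test'[OF summable_mult2[OF sm, of "measure \<sigma> UNIV"]])
        fix n
        have "(\<integral>s. norm (a n * (of_real s * z) ^ n) \<partial>\<sigma>) \<le> (\<integral>s. cmod (a n * z ^ n) \<partial>\<sigma>)"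
          using AE_le pow by (intro integral_mono_AE) auto
        then show "norm (\<integral>s. norm (a n * (of_real s * z) ^ n) \<partial>\<sigma>) \<le> cmod (a n * z ^ n) * measure \<sigma> UNIV"
          by (simp add: mult.commute)
      qed
    qed
    moreover have "(\<Sum>n. a n * (of_real s * z) ^ n) = f (of_real s * z)" for s
      using a by (simp add: sums_iff)
    moreover have "(\<integral>s. a n * (of_real s * z) ^ n \<partial>\<sigma>) = (a n * (\<integral>s. complex_of_real s ^ n \<partial>\<sigma>)) * z ^ n" for n
      by (simp add: power_mult_distrib)
    ultimately show ?thesis by (simp only: dilation_average_def)
  qed
  then have "dilation_average \<sigma> f holomorphic_on ball 0 r" for r
    by (intro power_series_holomorphic[where a = "\<lambda>n. a n * (\<integral>s. complex_of_real s ^ n \<partial>\<sigma>)"]) simp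
  then have "dilation_average \<sigma> f holomorphic_on (\<Union>r. ball 0 r)"
    by (intro holomorphic_on_UN_open) auto
  moreover have "(\<Union>r. ball (0::complex) r) = UNIV"
  proof (intro equalityI subsetI)
    fix x :: complex
    have "x \<in> ball 0 (cmod x + 1)" by simp
    then show "x \<in> (\<Union>r. ball 0 r)" by blast
  qed simp
  ultimately show ?thesis by simp
qed

text \<open>Cauchy-Schwarz, from the nonnegativity of the variance.\<close>

lemma integral_norm_power2_le:
  fixes h :: "real \<Rightarrow> complex"
  assumes h: "integrable \<sigma> h" and h2: "integrable \<sigma> (\<lambda>s. (cmod (h s))\<^sup>2)"
  shows "(cmod (\<integral>s. h s \<partial>\<sigma>))\<^sup>2 \<le> measure \<sigma> UNIV * (\<integral>s. (cmod (h s))\<^sup>2 \<partial>\<sigma>)"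
proof -
  let ?M = "measure \<sigma> UNIV" and ?I = "\<integral>s. cmod (h s) \<partial>\<sigma>" and ?J = "\<integral>s. (cmod (h s))\<^sup>2 \<partial>\<sigma>"
  have J0: "0 \<le> ?J" by simp
  have n: "integrable \<sigma> (\<lambda>s. cmod (h s))" using h by simp
  \<comment> \<open>The deviation from the mean is multiplied by \<open>?M\<close> to avoid a
    division; total mass 0 is treated separately below.\<close>
  have "0 \<le> (\<integral>s. (?M * cmod (h s) - ?I)\<^sup>2 \<partial>\<sigma>)" by simp
  also have "\<dots> = (\<integral>s. ?M\<^sup>2 * (cmod (h s))\<^sup>2 - 2 * ?M * ?I * cmod (h s) + ?I\<^sup>2 \<partial>\<sigma>)"
    by (simp add: power2_diff power_mult_distrib algebra_simps)
  also have "\<dots> = ?M\<^sup>2 * ?J - 2 * ?M * ?I * ?I + ?I\<^sup>2 * ?M"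
    using n h2 by simp
  also have "\<dots> = ?M * (?M * ?J - ?I\<^sup>2)"
    by (simp add: power2_eq_square algebra_simps)
  finally have *: "0 \<le> ?M * (?M * ?J - ?I\<^sup>2)" .
  have "?I\<^sup>2 \<le> ?M * ?J"
  proof (cases "?M = 0")
    case True
    then have "UNIV \<in> null_sets \<sigma>"
      by (simp add: null_sets_def emeasure_eq_measure)
    then have "AE s in \<sigma>. cmod (h s) = 0" by (rule AE_I') auto
    then have "?I = 0" by (rule integral_eq_zero_AE)
    then show ?thesis using True by simp
  next
    case False
    then have "?M > 0" by (simp add: less_le)
    then show ?thesis using * by (simp add: zero_le_mult_iff)
  qed
  moreover have "(cmod (\<integral>s. h s \<partial>\<sigma>))\<^sup>2 \<le> ?I\<^sup>2"
    by (intro power_mono integral_norm_bound) auto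
  ultimately show ?thesis by (rule order_trans[rotated])
qed

text \<open>Cauchy-Schwarz in \<open>s\<close> gives one factor
  \<open>measure \<sigma> UNIV\<close>; after Tonelli, contractivity of each dilation leaves the
  second.\<close>

lemma dilation_average_bound:
  assumes f: "f \<in> Fock"
  shows "(\<integral>\<^sup>+z. ennreal ((cmod (dilation_average \<sigma> f z))\<^sup>2) \<partial>gauss)
           \<le> ennreal ((measure \<sigma> UNIV * norm_gauss f)\<^sup>2)"
proof -
  interpret pair_sigma_finite gauss \<sigma> ..
  let ?M = "measure \<sigma> UNIV"
  note [measurable] = FockD(3)[OF f]
  have f2: "continuous_on UNIV (\<lambda>w. (cmod (f w))\<^sup>2)"
    using FockD(2)[OF f] by (intro continuous_intros)
  have "(\<integral>\<^sup>+z. ennreal ((cmod (dilation_average \<sigma> f z))\<^sup>2) \<partial>gauss) \<le>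
        (\<integral>\<^sup>+z. ennreal ?M * (\<integral>\<^sup>+s. ennreal ((cmod (f (of_real s * z)))\<^sup>2) \<partial>\<sigma>) \<partial>gauss)"
  proof (rule nn_integral_mono)
    fix z
    have "(cmod (dilation_average \<sigma> f z))\<^sup>2 \<le> ?M * (\<integral>s. (cmod (f (of_real s * z)))\<^sup>2 \<partial>\<sigma>)"
      unfolding dilation_average_def
      by (rule integral_norm_power2_le[OF integrable_dilation[OF FockD(2)[OF f]] integrable_dilation[OF f2]])
    then have "ennreal ((cmod (dilation_average \<sigma> f z))\<^sup>2) \<le>
          ennreal (?M * (\<integral>s. (cmod (f (of_real s * z)))\<^sup>2 \<partial>\<sigma>))" by (rule ennreal_leI)
    also have "\<dots> = ennreal ?M * (\<integral>\<^sup>+s. ennreal ((cmod (f (of_real s * z)))\<^sup>2) \<partial>\<sigma>)"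
      using integrable_dilation[OF f2, of z] by (simp add: ennreal_mult nn_integral_eq_integral)
    finally show "ennreal ((cmod (dilation_average \<sigma> f z))\<^sup>2) \<le>
        ennreal ?M * (\<integral>\<^sup>+s. ennreal ((cmod (f (of_real s * z)))\<^sup>2) \<partial>\<sigma>)" .
  qed
  also have "\<dots> = ennreal ?M * (\<integral>\<^sup>+z. (\<integral>\<^sup>+s. ennreal ((cmod (f (of_real s * z)))\<^sup>2) \<partial>\<sigma>) \<partial>gauss)"
    by (rule nn_integral_cmult) measurable
  also have "(\<integral>\<^sup>+z. (\<integral>\<^sup>+s. ennreal ((cmod (f (of_real s * z)))\<^sup>2) \<partial>\<sigma>) \<partial>gauss) =
             (\<integral>\<^sup>+s. (\<integral>\<^sup>+z. ennreal ((cmod (f (of_real s * z)))\<^sup>2) \<partial>gauss) \<partial>\<sigma>)"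
    by (rule Fubini'[symmetric]) measurable
  also have "\<dots> \<le> (\<integral>\<^sup>+s. ennreal ((norm_gauss f)\<^sup>2) \<partial>\<sigma>)"
  proof (rule nn_integral_mono_AE)
    show "AE s in \<sigma>. (\<integral>\<^sup>+z. ennreal ((cmod (f (of_real s * z)))\<^sup>2) \<partial>gauss) \<le> ennreal ((norm_gauss f)\<^sup>2)"
      using AE_\<sigma>
    proof eventually_elim
      case (elim s)
      then show ?case
        using nn_integral_dilate_le[OF FockD(1)[OF f], of s] by (simp add: Fock_nn_integral[OF f])
    qed
  qed
  also have "\<dots> = ennreal ((norm_gauss f)\<^sup>2) * ennreal ?M"
    by (simp add: emeasure_eq_measure)
  also have "ennreal ?M * (ennreal ((norm_gauss f)\<^sup>2) * ennreal ?M) = ennreal ((?M * norm_gauss f)\<^sup>2)"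
    by (simp add: ennreal_mult[symmetric] power2_eq_square mult_ac)
  finally show ?thesis by (simp add: mult_left_mono)
qed

lemma dilation_average_Fock:
  assumes f: "f \<in> Fock"
  shows "dilation_average \<sigma> f \<in> Fock"
  using dilation_average_bound[OF f]
  by (intro FockI holomorphic_dilation_average FockD(1)[OF f]) (simp add: order_le_less_trans)

lemma norm_dilation_average:
  assumes f: "f \<in> Fock"
  shows "norm_gauss (dilation_average \<sigma> f) \<le> measure \<sigma> UNIV * norm_gauss f"
proof -
  have "(norm_gauss (dilation_average \<sigma> f))\<^sup>2 \<le> (measure \<sigma> UNIV * norm_gauss f)\<^sup>2"
    using dilation_average_bound[OF f] by (simp add: Fock_nn_integral[OF dilation_average_Fock[OF f]])
  then show ?thesis by (rule power2_le_imp_le) simp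
qed

lemma dilation_average_bounded_ops: "dilation_average \<sigma> \<in> bounded_ops"
  unfolding bounded_ops_def
proof (intro CollectI conjI ballI allI exI)
  fix f g assume "f \<in> Fock" "g \<in> Fock"
  then show "dilation_average \<sigma> (\<lambda>z. f z + g z) = (\<lambda>z. dilation_average \<sigma> f z + dilation_average \<sigma> g z)"
    by (intro ext) (simp only: dilation_average_def,
      intro Bochner_Integration.integral_add integrable_dilation FockD(2))
next
  fix c f assume "f \<in> Fock"
  then show "dilation_average \<sigma> (\<lambda>z. c * f z) = (\<lambda>z. c * dilation_average \<sigma> f z)"
    by (simp add: fun_eq_iff dilation_average_def)
qed (use dilation_average_Fock norm_dilation_average in auto)

end

subsection \<open>Toeplitz operators\<close>

lemma Fock_add:
  assumes "f \<in> Fock" "g \<in> Fock"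
  shows "(\<lambda>z. f z + g z) \<in> Fock"
proof -
  note [measurable] = FockD(3)[OF assms(1)] FockD(3)[OF assms(2)]
  have "integrable gauss (\<lambda>z. (cmod (f z + g z))\<^sup>2)"
  proof (rule Bochner_Integration.integrable_bound)
    show "integrable gauss (\<lambda>z. 2 * (cmod (f z))\<^sup>2 + 2 * (cmod (g z))\<^sup>2)"
      using assms by (auto intro!: FockD(4))
    have "(cmod (f z + g z))\<^sup>2 \<le> 2 * (cmod (f z))\<^sup>2 + 2 * (cmod (g z))\<^sup>2" for z
    proof -
      have "(cmod (f z + g z))\<^sup>2 \<le> (cmod (f z) + cmod (g z))\<^sup>2"
        by (intro power_mono norm_triangle_ineq norm_ge_zero)
      also have "\<dots> \<le> 2 * (cmod (f z))\<^sup>2 + 2 * (cmod (g z))\<^sup>2"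
        using sum_squares_bound[of "cmod (f z)" "cmod (g z)"] by (simp add: power2_sum)
      finally show ?thesis .
    qed
    then show "AE z in gauss. norm ((cmod (f z + g z))\<^sup>2) \<le> norm (2 * (cmod (f z))\<^sup>2 + 2 * (cmod (g z))\<^sup>2)"
      by simp
  qed measurable
  then show ?thesis
    using assms by (auto simp: Fock_def L2_gauss_def intro: holomorphic_intros)
qed

lemma Fock_cmult:
  assumes "f \<in> Fock"
  shows "(\<lambda>z. c * f z) \<in> Fock"
  using assms by (auto simp: Fock_def L2_gauss_def norm_mult power_mult_distrib intro: holomorphic_intros)

lemma Fock_diff:
  assumes "f \<in> Fock" "g \<in> Fock"
  shows "(\<lambda>z. f z - g z) \<in> Fock"
  using Fock_add[OF assms(1) Fock_cmult[OF assms(2), of "-1"]] by simp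

text \<open>Closure of \<open>Fock\<close> under sums and multiples lets the agreement be used in
  the linearity clauses. This transfers boundedness to \<open>Hausdorff \<rho>\<close>, which is
  compared with an average of dilations on \<open>Fock\<close> only.\<close>

lemma bounded_ops_cong:
  assumes A: "A \<in> bounded_ops" and eq: "\<And>f. f \<in> Fock \<Longrightarrow> B f = A f"
  shows "B \<in> bounded_ops"
  using A unfolding bounded_ops_def by (simp add: eq Fock_add Fock_cmult)

text \<open>Two candidates for the \<open>THE\<close> in \<open>Fock_proj\<close> differ by an
  element of \<open>Fock\<close> orthogonal to itself, which is 0 by
  \<open>Fock_eq_0\<close>.\<close>

lemma Fock_proj_eqI:
  assumes h: "h \<in> borel_measurable borel" "integrable gauss (\<lambda>z. (cmod (h z))\<^sup>2)" and g: "g \<in> Fock"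
    and orth: "\<And>k. k \<in> Fock \<Longrightarrow> inner_gauss h k = inner_gauss g k"
  shows "Fock_proj h = g"
  unfolding Fock_proj_def
proof (rule the_equality)
  have hk: "integrable gauss (\<lambda>z. h z * cnj (k z))" if "k \<in> Fock" for k
    using L2_mult_integrable[OF h] FockD[OF that] by blast
  have diff: "inner_gauss (\<lambda>z. h z - g' z) k = inner_gauss h k - inner_gauss g' k"
    if "g' \<in> Fock" "k \<in> Fock" for g' k
    unfolding inner_gauss_def left_diff_distrib
    using that by (intro Bochner_Integration.integral_diff hk Fock_mult_integrable)
  show "g \<in> Fock \<and> (\<forall>k\<in>Fock. inner_gauss (\<lambda>z. h z - g z) k = 0)"
    using g by (simp add: diff orth)
  fix g' assume g': "g' \<in> Fock \<and> (\<forall>k\<in>Fock. inner_gauss (\<lambda>z. h z - g' z) k = 0)"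
  define d where "d = (\<lambda>z. g' z - g z)"
  have d: "d \<in> Fock" unfolding d_def using g g' by (intro Fock_diff) auto
  have "inner_gauss d d = inner_gauss g' d - inner_gauss g d"
    unfolding inner_gauss_def d_def left_diff_distrib
    using g g' d by (intro Bochner_Integration.integral_diff Fock_mult_integrable) (auto simp: d_def)
  also have "\<dots> = 0" using diff[of g' d] orth[of d] g' d by simp
  finally have "(\<integral>z. complex_of_real ((cmod (d z))\<^sup>2) \<partial>gauss) = 0"
    by (simp only: inner_gauss_def complex_norm_square)
  then have "(\<integral>z. (cmod (d z))\<^sup>2 \<partial>gauss) = 0"
    by (simp only: integral_complex_of_real of_real_eq_0_iff)
  then have "d = (\<lambda>_. 0)" using Fock_eq_0[OF d] by (simp add: norm_gauss_def)
  then show "g' = g" by (auto simp: d_def fun_eq_iff)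
qed

section \<open>Dilations and their averages as Toeplitz operators\<close>

lemma integral_lborel_scale:
  fixes F :: "complex \<Rightarrow> complex"
  assumes [measurable]: "F \<in> borel_measurable borel" and r: "r > 0"
  shows "(\<integral>z. F z \<partial>lborel) = (\<integral>z. of_real (r\<^sup>2) * F (of_real r * z) \<partial>lborel)"
proof -
  have "(\<integral>z. F z \<partial>lborel) =
        (\<integral>z. F z \<partial>density (distr lborel borel (\<lambda>x. 0 + r *\<^sub>R x)) (\<lambda>_. ennreal (\<bar>r\<bar> ^ DIM(complex))))"
    using lborel_affine[of r "0::complex"] r by simp
  also have "\<dots> = (\<integral>z. (r\<^sup>2) *\<^sub>R F z \<partial>distr lborel borel (\<lambda>x. 0 + r *\<^sub>R x))"
    using r by (subst integral_density) auto
  also have "\<dots> = (\<integral>z. (r\<^sup>2) *\<^sub>R F (0 + r *\<^sub>R z) \<partial>lborel)"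
    by (rule integral_distr) measurable
  finally show ?thesis by (simp add: scaleR_conv_of_real)
qed

lemma integral_gauss:
  fixes f :: "complex \<Rightarrow> complex"
  assumes "f \<in> borel_measurable borel"
  shows "(\<integral>z. f z \<partial>gauss) = (\<integral>z. of_real (exp (- (cmod z)\<^sup>2) / pi) * f z \<partial>lborel)"
  unfolding gauss_def using assms
  by (subst integral_density) (auto simp: scaleR_conv_of_real)

text \<open>This is the symbol of the Toeplitz operator that acts as dilation by \<open>s\<close>: substituting
  \<open>z = \<surd>s w\<close> turns \<open>\<langle>gauss_symbol s g, k\<rangle>\<close> into the inner product of the dilates of \<open>g\<close> and
  \<open>k\<close> by \<open>\<surd>s\<close>.\<close>

definition gauss_symbol :: "real \<Rightarrow> complex \<Rightarrow> real" where
  "gauss_symbol s z = exp (- (1 / s - 1) * (cmod z)\<^sup>2) / s"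

lemma borel_measurable_gauss_symbol [measurable]:
  "case_prod gauss_symbol \<in> borel_measurable (borel \<Otimes>\<^sub>M borel)"
  unfolding gauss_symbol_def by measurable

lemma integral_gauss_symbol:
  assumes g: "g \<in> Fock" and k: "k \<in> Fock" and s: "0 < s" "s \<le> 1"
  shows "(\<integral>z. of_real (gauss_symbol s z) * (g z * cnj (k z)) \<partial>gauss) =
         inner_gauss (\<lambda>z. g (of_real s * z)) k"
proof -
  note [measurable] = FockD(3)[OF g] FockD(3)[OF k]
  \<comment> \<open>The substitution z = r w turns the exponent -|z|^2 / s into -|w|^2, and its
    Jacobian r^2 = s cancels the factor 1 / s of the symbol.\<close>
  define r where "r = sqrt s"
  have r: "r > 0" "r \<le> 1" "r\<^sup>2 = s" using s by (auto simp: r_def)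
  have "(\<integral>z. of_real (gauss_symbol s z) * (g z * cnj (k z)) \<partial>gauss) =
        (\<integral>z. of_real (exp (- (cmod z)\<^sup>2) / pi) * (of_real (gauss_symbol s z) * (g z * cnj (k z))) \<partial>lborel)"
    by (rule integral_gauss) measurable
  also have "\<dots> = (\<integral>z. of_real (exp (- (cmod z)\<^sup>2 / s) / (pi * s)) * (g z * cnj (k z)) \<partial>lborel)"
  proof (rule Bochner_Integration.integral_cong[OF refl])
    fix z
    have "exp (- (cmod z)\<^sup>2) / pi * gauss_symbol s z = exp (- (cmod z)\<^sup>2 / s) / (pi * s)"
      by (simp add: gauss_symbol_def exp_add[symmetric] algebra_simps)
    then show "of_real (exp (- (cmod z)\<^sup>2) / pi) * (of_real (gauss_symbol s z) * (g z * cnj (k z))) =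
       of_real (exp (- (cmod z)\<^sup>2 / s) / (pi * s)) * (g z * cnj (k z))"
      by (simp only: mult.assoc[symmetric] of_real_mult[symmetric])
  qed
  also have "\<dots> = (\<integral>w. of_real (r\<^sup>2) * (of_real (exp (- (cmod (of_real r * w))\<^sup>2 / s) / (pi * s)) *
      (g (of_real r * w) * cnj (k (of_real r * w)))) \<partial>lborel)"
    by (rule integral_lborel_scale[OF _ r(1)]) measurable
  also have "\<dots> = (\<integral>w. of_real (exp (- (cmod w)\<^sup>2) / pi) *
      (g (of_real r * w) * cnj (k (of_real r * w))) \<partial>lborel)"
  proof (rule Bochner_Integration.integral_cong[OF refl])
    fix w
    have "r\<^sup>2 * (exp (- (cmod (of_real r * w))\<^sup>2 / s) / (pi * s)) = exp (- (cmod w)\<^sup>2) / pi"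
      using s r by (simp add: norm_mult power_mult_distrib)
    then show "of_real (r\<^sup>2) * (of_real (exp (- (cmod (of_real r * w))\<^sup>2 / s) / (pi * s)) *
      (g (of_real r * w) * cnj (k (of_real r * w)))) = of_real (exp (- (cmod w)\<^sup>2) / pi) *
      (g (of_real r * w) * cnj (k (of_real r * w)))"
      by (simp only: mult.assoc[symmetric] of_real_mult[symmetric])
  qed
  also have "\<dots> = inner_gauss (\<lambda>z. g (of_real r * z)) (\<lambda>z. k (of_real r * z))"
    unfolding inner_gauss_def by (rule integral_gauss[symmetric]) measurable
  \<comment> \<open>The dilation of \<open>k\<close> by \<open>r\<close> moves to \<open>g\<close>,
    where two dilations by \<open>r\<close> make one by \<open>s\<close>.\<close>
  also have "\<dots> = inner_gauss (\<lambda>z. g (of_real s * z)) k"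
    using inner_gauss_dilate[OF g k, of r] r by simp
  finally show ?thesis .
qed

text \<open>At z = 0 the integrand is 1 / s, whose integral may diverge, with default value 0. A
  lower bound \<open>\<delta>\<close> on \<open>s\<close> is therefore assumed where boundedness is
  claimed.\<close>

definition dilation_symbol :: "real measure \<Rightarrow> complex \<Rightarrow> complex" where
  "dilation_symbol \<sigma> z = of_real (\<integral>s. gauss_symbol s z \<partial>\<sigma>)"

context dilation_measure
begin

text \<open>Fubini applies because |g(sz) k(z)| \<le> |g(sz)|^2 + |k(z)|^2, whose Gaussian integral
  is bounded uniformly in \<open>s\<close> by contractivity.\<close>

lemma inner_dilation_average:
  assumes g: "g \<in> Fock" and k: "k \<in> Fock"
  shows "inner_gauss (dilation_average \<sigma> g) k = (\<integral>s. inner_gauss (\<lambda>z. g (of_real s * z)) k \<partial>\<sigma>)"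
proof -
  note [measurable] = FockD(3)[OF g] FockD(3)[OF k]
  have "(\<integral>s. (\<integral>z. g (of_real s * z) * cnj (k z) \<partial>gauss) \<partial>\<sigma>) =
        (\<integral>z. (\<integral>s. g (of_real s * z) * cnj (k z) \<partial>\<sigma>) \<partial>gauss)"
  proof (rule Fubini_complex)
    have "(\<integral>\<^sup>+s. (\<integral>\<^sup>+z. ennreal (cmod (g (of_real s * z) * cnj (k z))) \<partial>gauss) \<partial>\<sigma>) \<le>
       (\<integral>\<^sup>+s. ennreal ((norm_gauss g)\<^sup>2 + (norm_gauss k)\<^sup>2) \<partial>\<sigma>)"
    proof (rule nn_integral_mono_AE)
      show "AE s in \<sigma>. (\<integral>\<^sup>+z. ennreal (cmod (g (of_real s * z) * cnj (k z))) \<partial>gauss) \<le>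
         ennreal ((norm_gauss g)\<^sup>2 + (norm_gauss k)\<^sup>2)"
        using AE_\<sigma>
      proof eventually_elim
        case (elim s)
        have "cmod (g (of_real s * z) * cnj (k z)) \<le> (cmod (g (of_real s * z)))\<^sup>2 + (cmod (k z))\<^sup>2" for z
        proof -
          have "0 \<le> cmod (g (of_real s * z)) * cmod (k z)" by simp
          with sum_squares_bound[of "cmod (g (of_real s * z))" "cmod (k z)"]
          show ?thesis unfolding norm_mult complex_mod_cnj by linarith
        qed
        then have "(\<integral>\<^sup>+z. ennreal (cmod (g (of_real s * z) * cnj (k z))) \<partial>gauss) \<le>
          (\<integral>\<^sup>+z. ennreal ((cmod (g (of_real s * z)))\<^sup>2) + ennreal ((cmod (k z))\<^sup>2) \<partial>gauss)"
          by (intro nn_integral_mono) (simp add: ennreal_plus[symmetric] ennreal_leI del: ennreal_plus)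
        also have "\<dots> = (\<integral>\<^sup>+z. ennreal ((cmod (g (of_real s * z)))\<^sup>2) \<partial>gauss) +
            (\<integral>\<^sup>+z. ennreal ((cmod (k z))\<^sup>2) \<partial>gauss)"
          by (rule nn_integral_add) measurable
        also have "\<dots> \<le> ennreal ((norm_gauss g)\<^sup>2) + ennreal ((norm_gauss k)\<^sup>2)"
          using nn_integral_dilate_le[OF FockD(1)[OF g], of s] elim
          by (intro add_mono) (auto simp: Fock_nn_integral g k)
        finally show ?case by simp
      qed
    qed
    also have "\<dots> < \<infinity>" by (simp add: emeasure_eq_measure ennreal_mult_less_top)
    finally show "(\<integral>\<^sup>+s. (\<integral>\<^sup>+z. ennreal (cmod (g (of_real s * z) * cnj (k z))) \<partial>gauss) \<partial>\<sigma>) < \<infinity>" .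
  qed (auto intro: sigma_finite_measure_axioms gauss.sigma_finite_measure_axioms)
  then show ?thesis by (simp add: inner_gauss_def dilation_average_def)
qed

text \<open>For s \<le> 1 the exponent is nonpositive, which leaves 1 / s \<le> 1 /
  \<delta>.\<close>

lemma gauss_symbol_bounds:
  assumes "0 < \<delta>" "\<delta> \<le> s" "s \<le> 1"
  shows "0 \<le> gauss_symbol s z" "gauss_symbol s z \<le> 1 / \<delta>"
proof -
  have "gauss_symbol s z \<le> 1 / s"
    using assms unfolding gauss_symbol_def
    by (intro divide_right_mono) (auto intro!: mult_nonpos_nonneg)
  also have "\<dots> \<le> 1 / \<delta>" using assms by (simp add: frac_le)
  finally show "gauss_symbol s z \<le> 1 / \<delta>" .
  show "0 \<le> gauss_symbol s z" using assms by (simp add: gauss_symbol_def)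
qed

lemma integrable_gauss_symbol:
  assumes \<delta>: "0 < \<delta>" "AE s in \<sigma>. \<delta> \<le> s"
  shows "integrable \<sigma> (\<lambda>s. gauss_symbol s z)"
proof (rule integrable_const_bound[where B = "1 / \<delta>"])
  show "AE s in \<sigma>. norm (gauss_symbol s z) \<le> 1 / \<delta>"
    using AE_\<sigma> \<delta>(2) by eventually_elim (use gauss_symbol_bounds[OF \<delta>(1)] in auto)
qed measurable

lemma dilation_symbol_measurable [measurable]: "dilation_symbol \<sigma> \<in> borel_measurable borel"
  unfolding dilation_symbol_def by measurable

lemma dilation_symbol_bound:
  assumes \<delta>: "0 < \<delta>" "AE s in \<sigma>. \<delta> \<le> s"
  shows "cmod (dilation_symbol \<sigma> z) \<le> measure \<sigma> UNIV / \<delta>"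
proof -
  have "cmod (dilation_symbol \<sigma> z) \<le> (\<integral>s. norm (gauss_symbol s z) \<partial>\<sigma>)"
    using integral_norm_bound[of \<sigma> "\<lambda>s. gauss_symbol s z"] by (simp add: dilation_symbol_def)
  also have "\<dots> \<le> (\<integral>s. 1 / \<delta> \<partial>\<sigma>)"
  proof (rule integral_mono_AE)
    show "AE s in \<sigma>. norm (gauss_symbol s z) \<le> 1 / \<delta>"
      using AE_\<sigma> \<delta>(2) by eventually_elim (use gauss_symbol_bounds[OF \<delta>(1)] in auto)
  qed (use integrable_gauss_symbol[OF \<delta>] in auto)
  finally show ?thesis by simp
qed

lemma dilation_symbol_Linf:
  assumes \<delta>: "0 < \<delta>" "AE s in \<sigma>. \<delta> \<le> s"
  shows "dilation_symbol \<sigma> \<in> Linf"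
  using dilation_symbol_bound[OF \<delta>] by (auto simp: Linf_def)

text \<open>Tested against \<open>k\<close>, both sides are integrals over \<open>s\<close> of inner
  products of dilates: Fubini, dominated through the bound 1 / \<delta>, and
  \<open>integral_gauss_symbol\<close> on the left, \<open>inner_dilation_average\<close> on the
  right.\<close>

lemma Toeplitz_dilation_symbol:
  assumes \<delta>: "0 < \<delta>" "AE s in \<sigma>. \<delta> \<le> s" and g: "g \<in> Fock"
  shows "Toeplitz (dilation_symbol \<sigma>) g = dilation_average \<sigma> g"
  unfolding Toeplitz_def
proof (rule Fock_proj_eqI)
  note [measurable] = FockD(3)[OF g]
  let ?K = "measure \<sigma> UNIV / \<delta>"
  show "(\<lambda>z. dilation_symbol \<sigma> z * g z) \<in> borel_measurable borel" by measurable
  show "integrable gauss (\<lambda>z. (cmod (dilation_symbol \<sigma> z * g z))\<^sup>2)"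
  proof (rule Bochner_Integration.integrable_bound)
    show "integrable gauss (\<lambda>z. ?K\<^sup>2 * (cmod (g z))\<^sup>2)"
      using FockD(4)[OF g] by simp
    show "AE z in gauss. norm ((cmod (dilation_symbol \<sigma> z * g z))\<^sup>2) \<le> norm (?K\<^sup>2 * (cmod (g z))\<^sup>2)"
      using power_mono[OF dilation_symbol_bound[OF \<delta>] norm_ge_zero, where n = 2]
      by (auto simp: norm_mult power_mult_distrib intro!: mult_right_mono)
  qed measurable
  show "dilation_average \<sigma> g \<in> Fock" using g by (rule dilation_average_Fock)
  fix k assume k: "k \<in> Fock"
  note [measurable] = FockD(3)[OF k]
  have "inner_gauss (\<lambda>z. dilation_symbol \<sigma> z * g z) k =
      (\<integral>z. (\<integral>s. of_real (gauss_symbol s z) * (g z * cnj (k z)) \<partial>\<sigma>) \<partial>gauss)"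
    by (simp only: inner_gauss_def dilation_symbol_def integral_mult_left_zero integral_complex_of_real
        mult.assoc)
  also have "\<dots> = (\<integral>s. (\<integral>z. of_real (gauss_symbol s z) * (g z * cnj (k z)) \<partial>gauss) \<partial>\<sigma>)"
  proof (rule Fubini_complex)
    have "(\<integral>\<^sup>+z. (\<integral>\<^sup>+s. ennreal (cmod (of_real (gauss_symbol s z) * (g z * cnj (k z)))) \<partial>\<sigma>) \<partial>gauss) \<le>
       (\<integral>\<^sup>+z. ennreal (?K * cmod (g z * cnj (k z))) \<partial>gauss)"
    proof (rule nn_integral_mono)
      fix z
      have "(\<integral>\<^sup>+s. ennreal (cmod (of_real (gauss_symbol s z) * (g z * cnj (k z)))) \<partial>\<sigma>) \<le>
         (\<integral>\<^sup>+s. ennreal (1 / \<delta> * cmod (g z * cnj (k z))) \<partial>\<sigma>)"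
      proof (rule nn_integral_mono_AE)
        show "AE s in \<sigma>. ennreal (cmod (of_real (gauss_symbol s z) * (g z * cnj (k z)))) \<le>
           ennreal (1 / \<delta> * cmod (g z * cnj (k z)))"
          using AE_\<sigma> \<delta>(2)
        proof eventually_elim
          case (elim s)
          then have "cmod (of_real (gauss_symbol s z)) \<le> 1 / \<delta>"
            using gauss_symbol_bounds[OF \<delta>(1), of s z] by simp
          then show ?case
            unfolding norm_mult[of "of_real _"] by (intro ennreal_leI mult_right_mono) auto
        qed
      qed
      also have "\<dots> = ennreal (?K * cmod (g z * cnj (k z)))"
        using \<delta>(1) by (simp add: emeasure_eq_measure ennreal_mult[symmetric] mult_ac)
      finally show "(\<integral>\<^sup>+s. ennreal (cmod (of_real (gauss_symbol s z) * (g z * cnj (k z)))) \<partial>\<sigma>) \<le>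
        ennreal (?K * cmod (g z * cnj (k z)))" .
    qed
    also have "\<dots> < \<infinity>"
    proof -
      have "integrable gauss (\<lambda>z. ?K * cmod (g z * cnj (k z)))"
        using Fock_mult_integrable[OF g k] by (intro integrable_mult_right integrable_norm)
      then show ?thesis using \<delta>(1) by (simp add: integrable_iff_bounded)
    qed
    finally show "(\<integral>\<^sup>+z. (\<integral>\<^sup>+s. ennreal (cmod (of_real (gauss_symbol s z) * (g z * cnj (k z)))) \<partial>\<sigma>) \<partial>gauss) < \<infinity>" .
  qed (auto intro: sigma_finite_measure_axioms gauss.sigma_finite_measure_axioms)
  also have "\<dots> = (\<integral>s. inner_gauss (\<lambda>z. g (of_real s * z)) k \<partial>\<sigma>)"
  proof (rule integral_cong_AE)
    show "AE s in \<sigma>. (\<integral>z. of_real (gauss_symbol s z) * (g z * cnj (k z)) \<partial>gauss) =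
       inner_gauss (\<lambda>z. g (of_real s * z)) k"
      using AE_\<sigma> by eventually_elim (use integral_gauss_symbol[OF g k] in auto)
  qed (unfold inner_gauss_def, measurable)
  also have "\<dots> = inner_gauss (dilation_average \<sigma> g) k"
    by (rule inner_dilation_average[OF g k, symmetric])
  finally show "inner_gauss (\<lambda>z. dilation_symbol \<sigma> z * g z) k = inner_gauss (dilation_average \<sigma> g) k" .
qed

end

subsection \<open>Truncation\<close>

lemma norm_gauss_const_0 [simp]: "norm_gauss (\<lambda>_. 0) = 0"
  by (simp add: norm_gauss_def)

lemma op_norm_tendsto_0:
  assumes le: "\<And>n f. f \<in> Fock \<Longrightarrow> norm_gauss (A n f) \<le> c n * norm_gauss f"
    and c: "\<And>n. 0 \<le> c n" "c \<longlonglongrightarrow> 0"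
  shows "(\<lambda>n. op_norm (A n)) \<longlonglongrightarrow> 0"
proof (rule tendsto_sandwich[OF _ _ tendsto_const c(2)])
  have zero: "(\<lambda>_. 0) \<in> {f \<in> Fock. norm_gauss f \<le> 1}"
    by (simp add: Fock_def L2_gauss_def)
  have le_c: "norm_gauss (A n f) \<le> c n" if "f \<in> {f \<in> Fock. norm_gauss f \<le> 1}" for n f
    using le[of f n] mult_left_le[of "norm_gauss f" "c n"] c(1)[of n] that by simp
  show "\<forall>\<^sub>F n in sequentially. op_norm (A n) \<le> c n"
  proof (rule always_eventually, rule allI)
    fix n show "op_norm (A n) \<le> c n"
      unfolding op_norm_def using zero by (intro cSUP_least le_c) auto
  qed
  show "\<forall>\<^sub>F n in sequentially. 0 \<le> op_norm (A n)"
  proof (rule always_eventually, rule allI)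
    fix n
    \<comment> \<open>The real supremum dominates its members because \<open>le_c\<close> bounds
      them; the zero function supplies a member.\<close>
    have "norm_gauss (A n (\<lambda>_. 0)) \<le> op_norm (A n)"
      unfolding op_norm_def by (rule cSUP_upper[OF zero]) (auto intro!: bdd_aboveI2 le_c)
    then show "0 \<le> op_norm (A n)" by (rule order_trans[OF norm_gauss_nonneg])
  qed
qed

context dilation_measure
begin

lemma measure_density_indicator:
  assumes [measurable]: "A \<in> sets borel"
  shows "measure (density \<sigma> (\<lambda>s. ennreal (indicator A s))) UNIV = measure \<sigma> A"
  by (simp add: measure_def emeasure_density ennreal_indicator)

lemma dilation_measure_density:
  assumes [measurable]: "A \<in> sets borel"
  shows "dilation_measure (density \<sigma> (\<lambda>s. ennreal (indicator A s)))"
proof (intro dilation_measure.intro dilation_measure_axioms.intro)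
  show "finite_measure (density \<sigma> (\<lambda>s. ennreal (indicator A s)))"
    by (rule finite_measureI) (simp add: emeasure_density ennreal_indicator)
  show "AE s in density \<sigma> (\<lambda>s. ennreal (indicator A s)). 0 < s \<and> s \<le> 1"
    using AE_\<sigma> by (subst AE_density) auto
qed simp

lemma dilation_average_split:
  assumes [measurable]: "A \<in> sets borel" and f: "f \<in> Fock"
  shows "dilation_average (density \<sigma> (\<lambda>s. ennreal (indicator A s))) f z
           + dilation_average (density \<sigma> (\<lambda>s. ennreal (indicator (- A) s))) f z = dilation_average \<sigma> f z"
proof -
  note [measurable] = FockD(3)[OF f]
  have int: "integrable \<sigma> (\<lambda>s. indicator B s *\<^sub>R f (of_real s * z))" if "B \<in> sets borel" for B
    using that by (intro integrable_mult_indicator integrable_dilation FockD(2)[OF f]) simp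
  have "dilation_average (density \<sigma> (\<lambda>s. ennreal (indicator B s))) f z =
        (\<integral>s. indicator B s *\<^sub>R f (of_real s * z) \<partial>\<sigma>)" if [measurable]: "B \<in> sets borel" for B
    unfolding dilation_average_def by (subst integral_density) auto
  moreover have "(\<integral>s. indicator A s *\<^sub>R f (of_real s * z) \<partial>\<sigma>) + (\<integral>s. indicator (- A) s *\<^sub>R f (of_real s * z) \<partial>\<sigma>)
     = (\<integral>s. indicator A s *\<^sub>R f (of_real s * z) + indicator (- A) s *\<^sub>R f (of_real s * z) \<partial>\<sigma>)"
    by (rule Bochner_Integration.integral_add[symmetric]) (intro int, simp)+
  moreover have "indicator A s *\<^sub>R f (of_real s * z) + indicator (- A) s *\<^sub>R f (of_real s * z) = f (of_real s * z)" for s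
    by (simp add: indicator_def)
  ultimately show ?thesis by (simp add: dilation_average_def)
qed

text \<open>In any closed algebra containing the Toeplitz operators, truncations of
  \<open>\<sigma>\<close> to s \<ge> \<open>\<delta> n\<close> give Toeplitz operators that converge
  to \<open>B\<close> in norm. A general \<open>B\<close> that agrees on \<open>Fock\<close> allows
  the application to \<open>Hausdorff \<rho>\<close>.\<close>

lemma dilation_average_in_Toeplitz_algebra:
  assumes B: "B \<in> bounded_ops" and eq: "\<And>f. f \<in> Fock \<Longrightarrow> B f = dilation_average \<sigma> f"
  shows "B \<in> Toeplitz_algebra"
  unfolding Toeplitz_algebra_def hull_def
proof (intro InterI, elim CollectE conjE)
  fix \<A> assume alg: "cstar_subalgebra \<A>" and sub: "Toeplitz ` Linf \<subseteq> \<A>"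
  define \<delta> where "\<delta> = (\<lambda>n. 1 / (real n + 1))"
  define \<sigma>' where "\<sigma>' = (\<lambda>n. density \<sigma> (\<lambda>s. ennreal (indicator {\<delta> n..} s)))"
  define \<tau> where "\<tau> = (\<lambda>n. density \<sigma> (\<lambda>s. ennreal (indicator (- {\<delta> n..}) s)))"
  define S where "S = (\<lambda>n. Toeplitz (dilation_symbol (\<sigma>' n)))"
  have \<delta>: "\<delta> n > 0" for n by (simp add: \<delta>_def)
  have \<sigma>': "dilation_measure (\<sigma>' n)" and \<tau>: "dilation_measure (\<tau> n)" for n
    unfolding \<sigma>'_def \<tau>_def by (auto intro!: dilation_measure_density)
  have AE': "AE s in \<sigma>' n. \<delta> n \<le> s" for n
    unfolding \<sigma>'_def by (subst AE_density) (auto simp: indicator_def)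
  have S_mem: "S n \<in> \<A>" for n
    using sub dilation_measure.dilation_symbol_Linf[OF \<sigma>' \<delta> AE'] by (auto simp: S_def)
  have "(\<lambda>n. op_norm (\<lambda>f z. S n f z - B f z)) \<longlonglongrightarrow> 0"
  proof (rule op_norm_tendsto_0)
    fix n f assume f: "f \<in> Fock"
    \<comment> \<open>\<open>S n\<close> averages over s \<ge> \<open>\<delta> n\<close>, so the
      error is the average over the complementary part \<open>\<tau> n\<close>.\<close>
    have "S n f z - B f z = - dilation_average (\<tau> n) f z" for z
      using dilation_average_split[of "{\<delta> n..}" f z] f
        dilation_measure.Toeplitz_dilation_symbol[OF \<sigma>' \<delta> AE' f, of n]
      by (simp add: S_def eq \<sigma>'_def \<tau>_def algebra_simps)
    then have "norm_gauss (\<lambda>z. S n f z - B f z) = norm_gauss (dilation_average (\<tau> n) f)"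
      by (simp add: norm_gauss_def)
    also have "\<dots> \<le> measure (\<tau> n) UNIV * norm_gauss f"
      by (rule dilation_measure.norm_dilation_average[OF \<tau> f])
    finally show "norm_gauss (\<lambda>z. S n f z - B f z) \<le> measure (\<tau> n) UNIV * norm_gauss f" .
  next
    have "(\<lambda>n. measure \<sigma> (- {\<delta> n..})) \<longlonglongrightarrow> measure \<sigma> (\<Inter>n. - {\<delta> n..})"
    proof (rule finite_Lim_measure_decseq)
      show "decseq (\<lambda>n. - {\<delta> n..})"
        by (auto simp: decseq_def \<delta>_def frac_le intro: order_trans)
    qed auto
    \<comment> \<open>The intersection consists of the s \<le> 0, which \<open>\<sigma>\<close> does
      not charge.\<close>
    moreover have "measure \<sigma> (\<Inter>n. - {\<delta> n..}) = 0"
    proof -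
      have "s \<notin> (\<Inter>n. - {\<delta> n..})" if s: "0 < s" for s
      proof -
        obtain n where "1 / real (Suc n) < s" using s by (rule nat_approx_posE)
        then show ?thesis by (auto simp: \<delta>_def add.commute intro!: exI[of _ n])
      qed
      then have "AE s in \<sigma>. s \<notin> (\<Inter>n. - {\<delta> n..})"
        using AE_\<sigma> by (auto elim!: eventually_mono)
      moreover have "(\<Inter>n. - {\<delta> n..}) \<in> sets \<sigma>" by simp
      ultimately have "emeasure \<sigma> (\<Inter>n. - {\<delta> n..}) = 0"
        using AE_iff_null_sets by blast
      then show ?thesis by (simp add: measure_def)
    qed
    ultimately show "(\<lambda>n. measure (\<tau> n) UNIV) \<longlonglongrightarrow> 0"
      by (simp add: \<tau>_def measure_density_indicator)
  qed simp
  then show "B \<in> \<A>"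
    using alg B S_mem unfolding cstar_subalgebra_def by blast
qed

end

subsection \<open>Hausdorff operators\<close>

lemma power_in_Fock: "(\<lambda>z. z ^ n) \<in> Fock"
proof (rule FockI)
  show "(\<integral>\<^sup>+z. ennreal ((cmod (z ^ n))\<^sup>2) \<partial>gauss) < \<infinity>"
    using nn_integral_gauss_power_finite[of "n * 2"] by (simp add: norm_power power_mult)
qed (intro holomorphic_intros)

text \<open>Allows this norm to be cancelled when an eigenvalue is compared with the operator
  bound.\<close>

lemma norm_gauss_power_pos: "norm_gauss (\<lambda>z. z ^ n) > 0"
proof (rule ccontr)
  assume "\<not> norm_gauss (\<lambda>z. z ^ n) > 0"
  then have "norm_gauss (\<lambda>z. z ^ n) = 0" using norm_gauss_nonneg[of "\<lambda>z. z ^ n"] by linarith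
  then have "(\<lambda>z::complex. z ^ n) = (\<lambda>_. 0)" using Fock_eq_0[OF power_in_Fock] by blast
  from fun_cong[OF this, of 1] show False by simp
qed

section \<open>The two implications for a measure on the open half-line\<close>

context
  fixes \<rho> :: "real measure"
  assumes sets_\<rho>: "sets \<rho> = sets (restrict_space borel {0<..})"
begin

lemma space_\<rho>: "space \<rho> = {0<..}"
  using sets_eq_imp_space_eq[OF sets_\<rho>] by (simp add: space_restrict_space)

lemma measurable_\<rho>:
  assumes "f \<in> measurable borel M"
  shows "f \<in> measurable \<rho> M"
  using measurable_restrict_space1[OF assms, of "{0<..}"] measurable_cong_sets[OF sets_\<rho> refl] by blast

lemma Ioo_in_sets_\<rho>: "a \<ge> 0 \<Longrightarrow> {a<..<b} \<in> sets \<rho>"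
  unfolding sets_\<rho> by (subst sets_restrict_space_iff) auto

lemma Ioc_in_sets_\<rho>: "a \<ge> 0 \<Longrightarrow> {a<..b} \<in> sets \<rho>"
  unfolding sets_\<rho> by (subst sets_restrict_space_iff) auto

lemma Hausdorff_bounded_if:
  assumes null: "emeasure \<rho> {0<..<1} = 0" and fin: "(\<integral>\<^sup>+t\<in>{1..}. ennreal (1 / t) \<partial>\<rho>) < \<infinity>"
  shows "Hausdorff_bounded \<rho> \<and> Hausdorff \<rho> \<in> Toeplitz_algebra"
proof -
  have inv[measurable]: "(\<lambda>t::real. 1 / t) \<in> borel_measurable \<rho>"
    by (rule measurable_\<rho>) measurable
  define \<nu> where "\<nu> = density \<rho> (\<lambda>t. ennreal (1 / t))"
  have inv\<nu>: "(\<lambda>t::real. 1 / t) \<in> borel_measurable \<nu>" unfolding \<nu>_def by simp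
  define \<sigma> where "\<sigma> = distr \<nu> borel (\<lambda>t. 1 / t)"
  have AE_ge: "AE t in \<rho>. 1 \<le> t"
  proof (rule AE_I')
    show "{0<..<1} \<in> null_sets \<rho>" using null Ioo_in_sets_\<rho>[of 0 1] by (simp add: null_sets_def)
    show "{t \<in> space \<rho>. \<not> 1 \<le> t} \<subseteq> {0<..<1}" by (auto simp: space_\<rho>)
  qed
  have nonneg: "AE t in \<rho>. 0 \<le> 1 / t" using AE_ge by eventually_elim simp
  interpret dilation_measure \<sigma>
  proof (intro dilation_measure.intro dilation_measure_axioms.intro)
    \<comment> \<open>The total mass of \<open>\<sigma>\<close> is the integral in the hypothesis,
      as almost every \<open>t\<close> is at least 1.\<close>
    have "emeasure \<sigma> UNIV = emeasure \<nu> (space \<nu>)"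
      unfolding \<sigma>_def by (subst emeasure_distr[OF inv\<nu>]) auto
    also have "\<dots> = (\<integral>\<^sup>+t. ennreal (1 / t) * indicator (space \<rho>) t \<partial>\<rho>)"
      unfolding \<nu>_def by (subst emeasure_density) (auto simp: inv)
    also have "\<dots> = (\<integral>\<^sup>+t\<in>{1..}. ennreal (1 / t) \<partial>\<rho>)"
      by (rule nn_integral_cong_AE) (use AE_ge AE_space in \<open>eventually_elim, auto\<close>)
    finally show "finite_measure \<sigma>" using fin by (intro finite_measureI) (auto simp: \<sigma>_def)
    have "AE t in \<nu>. 0 < 1 / t \<and> 1 / t \<le> 1"
      unfolding \<nu>_def by (subst AE_density) (use AE_ge in \<open>auto elim!: eventually_mono\<close>)
    then show "AE s in \<sigma>. 0 < s \<and> s \<le> 1"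
      unfolding \<sigma>_def by (subst AE_distr_iff[OF inv\<nu>]) auto
  qed (simp add: \<sigma>_def)
  \<comment> \<open>Change of variables s = 1 / t, for the value of the integral and for its
    absolute convergence.\<close>
  have transfer: "Hausdorff \<rho> f z = dilation_average \<sigma> f z"
    "integrable \<rho> (\<lambda>t. f (z / of_real t) * of_real (1 / t))" if f: "f \<in> Fock" for f z
  proof -
    note [measurable] = FockD(3)[OF f]
    have m: "(\<lambda>s. f (of_real s * z)) \<in> borel_measurable borel" by measurable
    have m\<rho>: "(\<lambda>t. f (of_real (1 / t) * z)) \<in> borel_measurable \<rho>" by (rule measurable_\<rho>) measurable
    have eq: "(1 / t) *\<^sub>R f (of_real (1 / t) * z) = f (z / of_real t) * of_real (1 / t)" for t
      by (simp add: scaleR_conv_of_real field_simps)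
    have "dilation_average \<sigma> f z = (\<integral>t. f (of_real (1 / t) * z) \<partial>\<nu>)"
      unfolding dilation_average_def \<sigma>_def by (rule integral_distr[OF inv\<nu> m])
    also have "\<dots> = (\<integral>t. (1 / t) *\<^sub>R f (of_real (1 / t) * z) \<partial>\<rho>)"
      unfolding \<nu>_def by (rule integral_density[OF m\<rho> inv nonneg])
    finally show "Hausdorff \<rho> f z = dilation_average \<sigma> f z"
      by (simp only: eq Hausdorff_def)
    have "integrable \<nu> (\<lambda>t. f (of_real (1 / t) * z))"
      using integrable_dilation[OF FockD(2)[OF f], of z] unfolding \<sigma>_def
      by (rule integrable_distr[OF inv\<nu>])
    then have "integrable \<rho> (\<lambda>t. (1 / t) *\<^sub>R f (of_real (1 / t) * z))"
      unfolding \<nu>_def by (subst (asm) integrable_density[OF m\<rho> inv nonneg])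
    then show "integrable \<rho> (\<lambda>t. f (z / of_real t) * of_real (1 / t))"
      by (simp only: eq)
  qed
  have eq: "Hausdorff \<rho> f = dilation_average \<sigma> f" if "f \<in> Fock" for f
    using transfer(1)[OF that] by blast
  have "Hausdorff \<rho> \<in> bounded_ops" by (rule bounded_ops_cong[OF dilation_average_bounded_ops eq])
  then show ?thesis
    using dilation_average_in_Toeplitz_algebra[OF _ eq] transfer(2) by (auto simp: Hausdorff_bounded_def)
qed

text \<open>The moments are the eigenvalues on the monomials \<open>z ^ n\<close>, so the operator
  bound is a common bound \<open>C\<close>.\<close>

lemma Hausdorff_bounded_moments:
  assumes "Hausdorff_bounded \<rho>"
  obtains C where "\<And>n. (\<integral>\<^sup>+t. ennreal ((1 / t) ^ Suc n) \<partial>\<rho>) \<le> ennreal C"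
proof -
  obtain C where C: "\<And>f. f \<in> Fock \<Longrightarrow> norm_gauss (Hausdorff \<rho> f) \<le> C * norm_gauss f"
    using assms unfolding Hausdorff_bounded_def bounded_ops_def by blast
  have int_all: "integrable \<rho> (\<lambda>t. f (z / of_real t) * of_real (1 / t))" if "f \<in> Fock" for f z
    using assms that by (simp add: Hausdorff_bounded_def)
  have "(\<integral>\<^sup>+t. ennreal ((1 / t) ^ Suc n) \<partial>\<rho>) \<le> ennreal C" for n
  proof -
    define l where "l = (\<integral>t. (1 / t) ^ Suc n \<partial>\<rho>)"
    \<comment> \<open>Absolute convergence for \<open>z ^ n\<close> at the point 1 makes
      \<open>l\<close> a genuine integral and not the default 0.\<close>
    have "integrable \<rho> (\<lambda>t. (1 / of_real t) ^ n * complex_of_real (1 / t))"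
      by (rule int_all[OF power_in_Fock, of 1])
    moreover have "(1 / of_real t) ^ n * complex_of_real (1 / t) = complex_of_real ((1 / t) ^ Suc n)" for t
      by simp
    ultimately have int: "integrable \<rho> (\<lambda>t. (1 / t) ^ Suc n)"
      by (simp only: complex_of_real_integrable_eq)
    have nonneg: "AE t in \<rho>. 0 \<le> (1 / t) ^ Suc n" by (rule AE_I2) (simp add: space_\<rho>)
    have "Hausdorff \<rho> (\<lambda>z. z ^ n) z = complex_of_real l * z ^ n" for z
    proof -
      have "(z / of_real t) ^ n * of_real (1 / t) = complex_of_real ((1 / t) ^ Suc n) * z ^ n" for t
        by (simp add: power_divide)
      then show ?thesis
        by (simp only: Hausdorff_def l_def integral_mult_left_zero integral_complex_of_real)
    qed
    then have "norm_gauss (Hausdorff \<rho> (\<lambda>z. z ^ n)) = \<bar>l\<bar> * norm_gauss (\<lambda>z. z ^ n)"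
      by (simp add: norm_gauss_def norm_mult power_mult_distrib real_sqrt_mult)
    then have "\<bar>l\<bar> \<le> C" using C[OF power_in_Fock[of n]] norm_gauss_power_pos[of n] by simp
    then show ?thesis
      using nn_integral_eq_integral[OF int nonneg] by (simp add: l_def ennreal_leI)
  qed
  then show ?thesis by (rule that)
qed

text \<open>The moment with n = 0 bounds the integral of 1 / t. On (0, c] with c < 1 one has (c /
  t)^(n+1) \<ge> 1, so by Markov's inequality the mass of this interval is at most C c^(n+1), which
  tends to 0.\<close>

lemma Hausdorff_bounded_only_if:
  assumes "Hausdorff_bounded \<rho>"
  shows "emeasure \<rho> {0<..<1} = 0" "(\<integral>\<^sup>+t\<in>{1..}. ennreal (1 / t) \<partial>\<rho>) < \<infinity>"
proof -
  obtain C where C: "\<And>n. (\<integral>\<^sup>+t. ennreal ((1 / t) ^ Suc n) \<partial>\<rho>) \<le> ennreal C"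
    using Hausdorff_bounded_moments[OF assms] by blast
  have "(\<integral>\<^sup>+t\<in>{1..}. ennreal (1 / t) \<partial>\<rho>) \<le> (\<integral>\<^sup>+t. ennreal (1 / t) \<partial>\<rho>)"
    by (intro nn_integral_mono) (auto simp: indicator_def)
  also have "\<dots> \<le> ennreal C" using C[of 0] by simp
  also have "\<dots> < \<infinity>" by simp
  finally show "(\<integral>\<^sup>+t\<in>{1..}. ennreal (1 / t) \<partial>\<rho>) < \<infinity>" .
  have zero: "{0<..c} \<in> null_sets \<rho>" if c: "0 < c" "c < 1" for c
  proof -
    have le: "emeasure \<rho> {0<..c} \<le> ennreal (C * c ^ Suc n)" for n
    proof -
      have "emeasure \<rho> {0<..c} = (\<integral>\<^sup>+t. indicator {0<..c} t \<partial>\<rho>)"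
        using Ioc_in_sets_\<rho>[of 0 c] by simp
      also have "\<dots> \<le> (\<integral>\<^sup>+t. ennreal (c ^ Suc n) * ennreal ((1 / t) ^ Suc n) \<partial>\<rho>)"
      proof (rule nn_integral_mono)
        fix t assume "t \<in> space \<rho>"
        then have t: "t > 0" by (simp add: space_\<rho>)
        have "1 \<le> (c * (1 / t)) ^ Suc n" if "t \<le> c"
          using that t by (intro one_le_power) simp
        then have "indicator {0<..c} t \<le> c ^ Suc n * (1 / t) ^ Suc n"
          using t c unfolding power_mult_distrib[symmetric] by (auto simp: indicator_def simp del: power_Suc)
        then have "ennreal (indicator {0<..c} t) \<le> ennreal (c ^ Suc n * (1 / t) ^ Suc n)"
          by (rule ennreal_leI)
        then show "indicator {0<..c} t \<le> ennreal (c ^ Suc n) * ennreal ((1 / t) ^ Suc n)"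
          using t c by (simp add: ennreal_indicator ennreal_mult[symmetric] del: power_Suc)
      qed
      also have "\<dots> = ennreal (c ^ Suc n) * (\<integral>\<^sup>+t. ennreal ((1 / t) ^ Suc n) \<partial>\<rho>)"
        by (rule nn_integral_cmult, rule measurable_\<rho>) measurable
      also have "\<dots> \<le> ennreal (c ^ Suc n) * ennreal C" by (rule mult_left_mono[OF C]) simp
      \<comment> \<open>For negative \<open>C\<close> both sides are truncated to 0 by
        \<open>ennreal\<close>.\<close>
      also have "\<dots> \<le> ennreal (C * c ^ Suc n)"
        using c by (cases "C \<ge> 0") (auto simp: ennreal_mult[symmetric] ennreal_neg mult.commute simp del: power_Suc)
      finally show ?thesis .
    qed
    have "(\<lambda>n. C * c ^ Suc n) \<longlonglongrightarrow> C * 0"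
      using c by (intro tendsto_mult tendsto_const LIMSEQ_Suc LIMSEQ_power_zero) simp
    then have "(\<lambda>n. ennreal (C * c ^ Suc n)) \<longlonglongrightarrow> ennreal 0"
      by (intro tendsto_ennrealI) simp
    then have "emeasure \<rho> {0<..c} \<le> ennreal 0"
      by (rule LIMSEQ_le_const) (use le in blast)
    then show ?thesis using Ioc_in_sets_\<rho>[of 0 c] by (simp add: null_sets_def)
  qed
  \<comment> \<open>The shift by 2 keeps every right endpoint in [1/2, 1), as \<open>zero\<close>
    demands a positive endpoint below 1.\<close>
  have "{0<..<1} = (\<Union>n. {0<..1 - 1 / real (n + 2)})"
  proof (intro equalityI subsetI)
    fix t :: real assume t: "t \<in> {0<..<1}"
    then have "0 < 1 - t" by simp
    then obtain n where "1 / real (Suc n) < 1 - t" by (rule nat_approx_posE)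
    moreover have "1 / real (n + 2) \<le> 1 / real (Suc n)" by (simp add: frac_le)
    ultimately have "t \<le> 1 - 1 / real (n + 2)" by linarith
    then show "t \<in> (\<Union>n. {0<..1 - 1 / real (n + 2)})" using t by auto
  next
    fix t assume "t \<in> (\<Union>n. {0<..1 - 1 / real (n + 2)})"
    then obtain n where "0 < t" "t \<le> 1 - 1 / real (n + 2)" by auto
    moreover have "1 / real (n + 2) > 0" by simp
    ultimately have "0 < t" "t < 1" by linarith+
    then show "t \<in> {0<..<1}" by simp
  qed
  moreover have "(\<Union>n. {0<..1 - 1 / real (n + 2)}) \<in> null_sets \<rho>"
    by (intro null_sets_UN zero) auto
  ultimately show "emeasure \<rho> {0<..<1} = 0" by auto
qed

end

theorem proposition3p35:
  fixes \<rho> :: "real measure"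
  assumes "sets \<rho> = sets (restrict_space borel {0<..})"
  shows "((emeasure \<rho> {0<..<1} = 0 \<and> (\<integral>\<^sup>+t\<in>{1..}. ennreal (1 / t) \<partial>\<rho>) < \<infinity>)
            \<longleftrightarrow> Hausdorff_bounded \<rho>) \<and>
         (Hausdorff_bounded \<rho> \<longleftrightarrow> Hausdorff_bounded \<rho> \<and> Hausdorff \<rho> \<in> Toeplitz_algebra)"
  \<comment> \<open>Condition (1) yields (2) and (3) together, (2) yields (1), and (3) contains (2)
    by its formulation.\<close>
  using Hausdorff_bounded_if[OF assms] Hausdorff_bounded_only_if[OF assms] by blast

end
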